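(* Let $d\geq 1$ be an integer and let $X_1,\ldots,X_{d+2}$ be i.i.d. random points with the standard normal distribution on $\mathbb{R}^d$. Then the probability $p_d(\mu_{\rm Gauss}):=\mathbb{P}\big[[X_1,\ldots,X_{d+2}]\text{ is a simplex}\big]$ is given by $$ p_d(\mu_{\rm Gauss}) = 2\cdot \mathbb{J}_{d+2,1}(\infty) = \frac{2(d+2)}{\sqrt{2\pi}}\int_{-\infty}^{+\infty}\Phi^{d+1}\left(\frac{\mathrm{i}x}{\sqrt{d+2}}\right)\mathrm{e}^{-x^2/2}\,\mathrm{d}x . $$
   Context: $[x_1,\ldots,x_n]$ denotes the convex hull of $x_1,\ldots,x_n$. Here $[X_1,\ldots,X_{d+2}]\subset\mathbb{R}^d$ "is a simplex" means that it is a $d$-dimensional simplex with $d+1$ vertices (almost surely, this happens if and only if one of the points lies in the convex hull of the remaining $d+1$ points); otherwise, almost surely, it is a polytope with $d+2$ vertices. For vectors $x_1,\ldots,x_m$, $\mathrm{pos}(x_1,\ldots,x_m)=\{\lambda_1x_1+\cdots+\lambda_mx_m:\lambda_1,\ldots,\lambda_m\geq 0\}$. For a polyhedral cone $C\subseteq\mathbb{R}^N$ (the positive hull of finitely many vectors), with linear hull $\mathrm{lin}\,C$ and $\lambda_{\mathrm{lin}\,C}$ the Lebesgue measure on $\mathrm{lin}\,C$, the solid angle of $C$ is $$\alpha(C)=\frac{\lambda_{\mathrm{lin}\,C}(\mathbb{B}^N\cap C)}{\lambda_{\mathrm{lin}\,C}(\mathbb{B}^N\cap \mathrm{lin}\,C)},$$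 where $\mathbb{B}^N$ is the closed Euclidean unit ball in $\mathbb{R}^N$. For $n\ge 2$, let $e_1,\ldots,e_n$ be the standard orthonormal basis of $\mathbb{R}^n$. The sum of internal angles at the vertices of the regular $(n-1)$-dimensional simplex $[e_1,\ldots,e_n]$ is $$\mathbb{J}_{n,1}(\infty):=n\cdot\alpha\big(\mathrm{pos}(e_2-e_1,\ldots,e_n-e_1)\big).$$ $\Phi$ is the standard normal cumulative distribution function, extended to an entire function on $\mathbb{C}$ by $$\Phi(z)=\frac12+\frac1{\sqrt{2\pi}}\int_0^z \mathrm{e}^{-t^2/2}\,\mathrm{d}t=\frac12+\frac{1}{\sqrt{2\pi}}\sum_{n=0}^\infty\frac{(-1)^n}{(2n+1)2^n n!}z^{2n+1},$$ and $\mathrm{i}$ is the imaginary unit. *)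

theory Defs
  imports
    "HOL-Probability.Probability"
    "HOL-Complex_Analysis.Complex_Analysis"
begin

definition std_gauss_density :: "'a::euclidean_space \<Rightarrow> real" where
  "std_gauss_density x = exp (- (norm x)\<^sup>2 / 2) / sqrt (2 * pi) ^ DIM('a)"

definition pos_hull :: "'a::real_vector set \<Rightarrow> 'a set" where
  "pos_hull S = {\<Sum>v\<in>S. c v *\<^sub>R v | c. \<forall>v\<in>S. 0 \<le> c v}"

definition orthonormal_basis_of :: "'a::euclidean_space set \<Rightarrow> 'a set \<Rightarrow> bool" where
  "orthonormal_basis_of L B \<longleftrightarrow>
     pairwise orthogonal B \<and> (\<forall>b\<in>B. norm b = 1) \<and> span B = L"

lemma orthonormal_basis_of_exists:
  assumes "subspace L"
  shows "\<exists>B. orthonormal_basis_of L B"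
  using orthonormal_basis_subspace[OF assms] unfolding orthonormal_basis_of_def by metis

(* Lebesgue measure on a linear subspace L: the image of the product Lebesgue measure under the
   linear isometry onto L given by an orthonormal basis of L, as in the definition of lborel. By
   rotation invariance of Lebesgue measure it does not depend on the basis. It is a Borel measure
   on the ambient space, concentrated on L. *)
definition subspace_lborel :: "'a::euclidean_space set \<Rightarrow> 'a measure" where
  "subspace_lborel L =
     (let B = (SOME B. orthonormal_basis_of L B)
      in distr (\<Pi>\<^sub>M b\<in>B. lborel) borel (\<lambda>x. \<Sum>b\<in>B. x b *\<^sub>R b))"

definition solid_angle :: "'a::euclidean_space set \<Rightarrow> real" where
  "solid_angle C =
     measure (subspace_lborel (span C)) (cball 0 1 \<inter> C) /
     measure (subspace_lborel (span C)) (cball 0 1 \<inter> span C)"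

(* The quantity J_{n,1}(infinity). Here e 1, ..., e n is meant to be an enumeration of the standard
   basis of an n-dimensional Euclidean space; the ambient dimension is carried by the type. *)
definition J1_inf :: "nat \<Rightarrow> (nat \<Rightarrow> 'a::euclidean_space) \<Rightarrow> real" where
  "J1_inf n e = real n * solid_angle (pos_hull ((\<lambda>k. e k - e 1) ` {2..n}))"

(* The integrand is entire, so the integral from 0 to z is taken along the segment. *)
definition Phi :: "complex \<Rightarrow> complex" where
  "Phi z = 1 / 2 +
     1 / complex_of_real (sqrt (2 * pi)) *
       contour_integral (linepath 0 z) (\<lambda>t. exp (- t\<^sup>2 / 2))"

end

theory Submission
  imports Defs
begin

text \<open>
  Put \<open>n = d + 2\<close> and regard the sample as \<open>d\<close> rows in \<open>\<real>\<^sup>n\<close>, the \<open>k\<close>-th row listing the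
  \<open>k\<close>-th coordinates of all the points. Almost surely the points satisfy exactly one affine
  relation \<open>\<lambda>\<close>, up to scaling: \<open>\<lambda>\<close> spans the orthogonal complement of the rows and of the
  all-ones vector. It is the Gale diagram of the points, written down explicitly as a vector of minors,
  \<open>gale_vector\<close>. By Radon's argument the convex hull is a simplex precisely when some entry of
  \<open>\<lambda>\<close> is nonzero and no other entry has the same sign (\<open>simplex_iff_gale_vector\<close>). This equivalence is
  exact, degenerate configurations included, so it also yields measurability of the event.

  The rows are independent standard Gaussian vectors, so their law is invariant under isometries of
  \<open>\<real>\<^sup>n\<close>. Isometries that fix the all-ones vector carry \<open>\<lambda>\<close> along up to sign, hence the law of
  \<open>\<lambda>\<close> on the hyperplane \<open>L\<close> of vectors with zero coordinate sum is invariant under all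
  reflections of \<open>L\<close>. Reflection-invariant probability measures on \<open>L\<close> without mass at the
  origin agree on cones (\<open>reflection_invariant_cone_unique\<close>). This uniqueness is Christensen's
  theorem on measures that give the same mass to all balls of the same radius
  (\<open>uniformly_distributed_unique\<close>), applied on a sphere. It is used for three measures:
  the law of \<open>\<lambda>\<close>, the uniform distribution on the unit ball of \<open>L\<close>, which defines the solid
  angle, and the centred Gaussian \<open>Z - mean Z\<close>. Each of the \<open>2 n\<close> admissible sign patterns
  places \<open>\<lambda>\<close> in a copy, up to sign, of the vertex cone \<open>pos (e\<^sub>2 - e\<^sub>1, \<dots>, e\<^sub>n - e\<^sub>1)\<close>, and so has
  probability equal to the solid angle of that cone.

  For the integral, the solid angle is the probability that the coordinates \<open>Z\<^sub>j\<close> with \<open>j \<noteq> 1\<close> all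
  exceed the mean. With the mean integrated out, this becomes a multiple of the integral of
  \<open>exp (- (y\<^sub>2\<^sup>2 + \<dots> + y\<^sub>n\<^sup>2) / 2 - (y\<^sub>2 + \<dots> + y\<^sub>n)\<^sup>2 / 2)\<close> over the positive orthant. The factor
  \<open>exp (- s\<^sup>2 / 2)\<close> is the characteristic function of the normal law, and writing it as such
  decouples the coordinates. What is left in each of them is a half-line Fourier transform of the Gaussian,
  which is \<open>\<Phi>\<close> on the imaginary axis (\<open>half_line_fourier_Phi\<close>).
\<close>

(* The dollar sign denotes only vector components below. *)
no_notation fps_nth (infixl \<open>$\<close> 75)

section \<open>Measures with equal mass on balls of equal radius\<close>

text \<open>
  Double counting of the pairs \<open>(x, y)\<close> with \<open>x \<in> U\<close> and \<open>dist x y < r\<close>. Integrating over \<open>y\<close> first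
  gives \<open>a r\<close> times the \<open>\<mu>\<close>-measure of \<open>U\<close>; integrating over \<open>x\<close> first gives the \<open>\<nu>\<close>-integral
  of the \<open>\<mu>\<close>-measure of \<open>U \<inter> ball y r\<close>. At every point \<open>y\<close> of the open set \<open>U\<close> the latter
  equals \<open>a r\<close> once \<open>r\<close> is small, so Fatou's lemma for \<open>r \<rightarrow> 0\<close> bounds the \<open>\<nu>\<close>-measure of \<open>U\<close>.
\<close>

lemma uniformly_distributed_open_le:
  fixes \<mu> \<nu> :: "'a::{metric_space, second_countable_topology} measure" and a :: "real \<Rightarrow> ennreal"
  assumes sets_mu[measurable_cong]: "sets \<mu> = sets borel" and sets_nu[measurable_cong]: "sets \<nu> = sets borel"
    and sigma: "sigma_finite_measure \<mu>" "sigma_finite_measure \<nu>"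
    and AE: "AE x in \<mu>. x \<in> S" "AE x in \<nu>. x \<in> S"
    and ball_mu: "\<And>x r. x \<in> S \<Longrightarrow> 0 < r \<Longrightarrow> emeasure \<mu> (ball x r) = a r"
    and ball_nu: "\<And>x r. x \<in> S \<Longrightarrow> 0 < r \<Longrightarrow> emeasure \<nu> (ball x r) = a r"
    and a: "\<And>r. 0 < r \<Longrightarrow> 0 < a r \<and> a r < \<top>"
    and U: "open U"
  shows "emeasure \<nu> U \<le> emeasure \<mu> U"
proof -
  interpret mu: sigma_finite_measure \<mu> by fact
  interpret nu: sigma_finite_measure \<nu> by fact
  interpret pair_sigma_finite \<mu> \<nu> ..
  have [measurable]: "U \<in> sets borel" using U by simp
  have eq: "emeasure \<mu> U = (\<integral>\<^sup>+y. emeasure \<mu> (U \<inter> ball y r) / a r \<partial>\<nu>)"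
    and meas: "(\<lambda>y. emeasure \<mu> (U \<inter> ball y r) / a r) \<in> borel_measurable \<nu>" if r: "0 < r" for r
  proof -
    let ?k = "\<lambda>x y. indicator U x * indicator {z. dist (fst z) (snd z) < r} (x, y) :: ennreal"
    have [measurable]: "{z :: 'a \<times> 'a. dist (fst z) (snd z) < r} \<in> sets (borel \<Otimes>\<^sub>M borel)"
      unfolding borel_prod by (intro borel_open open_Collect_less continuous_intros)
    have k: "(\<lambda>z. ?k (fst z) (snd z)) \<in> borel_measurable (\<mu> \<Otimes>\<^sub>M \<nu>)" by measurable
    have inner: "(\<integral>\<^sup>+x. ?k x y \<partial>\<mu>) = emeasure \<mu> (U \<inter> ball y r)" for y
    proof -
      have "(\<integral>\<^sup>+x. ?k x y \<partial>\<mu>) = (\<integral>\<^sup>+x. indicator (U \<inter> ball y r) x \<partial>\<mu>)"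
        by (intro nn_integral_cong) (auto simp: indicator_def dist_commute)
      then show ?thesis by simp
    qed
    have "(\<lambda>y. \<integral>\<^sup>+x. ?k x y \<partial>\<mu>) \<in> borel_measurable \<nu>"
      using k by measurable
    then have m: "(\<lambda>y. emeasure \<mu> (U \<inter> ball y r)) \<in> borel_measurable \<nu>"
      unfolding inner .
    then show "(\<lambda>y. emeasure \<mu> (U \<inter> ball y r) / a r) \<in> borel_measurable \<nu>" by measurable
    have "emeasure \<mu> U * a r = (\<integral>\<^sup>+x. indicator U x * a r \<partial>\<mu>)"
      by (simp add: nn_integral_multc)
    also have "\<dots> = (\<integral>\<^sup>+x. (\<integral>\<^sup>+y. ?k x y \<partial>\<nu>) \<partial>\<mu>)"
    proof (intro nn_integral_cong_AE, use AE(1) in eventually_elim)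
      fix x assume "x \<in> S"
      have "(\<integral>\<^sup>+y. ?k x y \<partial>\<nu>) = (\<integral>\<^sup>+y. indicator U x * indicator (ball x r) y \<partial>\<nu>)"
        by (intro nn_integral_cong) (auto simp: indicator_def)
      also have "\<dots> = indicator U x * a r"
        using ball_nu[OF \<open>x \<in> S\<close> r] by (cases "x \<in> U") auto
      finally show "indicator U x * a r = (\<integral>\<^sup>+y. ?k x y \<partial>\<nu>)" ..
    qed
    also have "\<dots> = (\<integral>\<^sup>+y. (\<integral>\<^sup>+x. ?k x y \<partial>\<mu>) \<partial>\<nu>)"
      using k by (intro Fubini'[symmetric]) (simp add: case_prod_beta')
    also have "\<dots> = (\<integral>\<^sup>+y. emeasure \<mu> (U \<inter> ball y r) \<partial>\<nu>)"
      unfolding inner ..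
    finally have *: "emeasure \<mu> U * a r = (\<integral>\<^sup>+y. emeasure \<mu> (U \<inter> ball y r) \<partial>\<nu>)" .
    have "emeasure \<mu> U = emeasure \<mu> U * a r / a r"
      using a[OF r] by (intro ennreal_mult_divide_eq[symmetric]) auto
    also have "\<dots> = (\<integral>\<^sup>+y. emeasure \<mu> (U \<inter> ball y r) / a r \<partial>\<nu>)"
      unfolding * using m by (simp add: nn_integral_divide)
    finally show "emeasure \<mu> U = \<dots>" .
  qed
  let ?u = "\<lambda>m y. emeasure \<mu> (U \<inter> ball y (1 / Suc m)) / a (1 / Suc m)"
  have "emeasure \<nu> U = (\<integral>\<^sup>+y. indicator U y \<partial>\<nu>)" by simp
  also have "\<dots> \<le> (\<integral>\<^sup>+y. liminf (\<lambda>m. ?u m y) \<partial>\<nu>)"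
  proof (intro nn_integral_mono_AE, use AE(2) in eventually_elim)
    fix y assume y: "y \<in> S"
    show "indicator U y \<le> liminf (\<lambda>m. ?u m y)"
    proof (cases "y \<in> U")
      case True
      then obtain e where e: "0 < e" "ball y e \<subseteq> U" using U openE by blast
      have "eventually (\<lambda>m. 1 / Suc m < e) sequentially"
        using e(1) by real_asymp
      then have "eventually (\<lambda>m. 1 \<le> ?u m y) sequentially"
      proof eventually_elim
        case (elim m)
        then have "U \<inter> ball y (1 / Suc m) = ball y (1 / Suc m)" using e(2) by auto
        then show ?case
          using ball_mu[OF y, of "1 / Suc m"] a[of "1 / Suc m"]
          by (simp add: ennreal_divide_self less_imp_neq[symmetric] less_top[symmetric])
      qed
      then show ?thesis by (intro Liminf_bounded) (auto simp: True)
    qed simp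
  qed
  also have "\<dots> \<le> liminf (\<lambda>m. \<integral>\<^sup>+y. ?u m y \<partial>\<nu>)"
    by (intro nn_integral_liminf meas) simp
  also have "\<dots> = emeasure \<mu> U"
    by (subst eq[symmetric]) (auto simp: Liminf_const)
  finally show ?thesis .
qed

text \<open>
  Christensen's uniqueness theorem, in the case where the two measures give balls the same mass, so that the
  constant of proportionality is 1. It is what replaces the uniqueness of Haar measure here.
\<close>

theorem uniformly_distributed_unique:
  fixes \<mu> \<nu> :: "'a::{metric_space, second_countable_topology} measure" and a :: "real \<Rightarrow> ennreal"
  assumes sets_mu: "sets \<mu> = sets borel" and sets_nu: "sets \<nu> = sets borel"
    and AE: "AE x in \<mu>. x \<in> S" "AE x in \<nu>. x \<in> S" and S: "x0 \<in> S"
    and ball_mu: "\<And>x r. x \<in> S \<Longrightarrow> 0 < r \<Longrightarrow> emeasure \<mu> (ball x r) = a r"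
    and ball_nu: "\<And>x r. x \<in> S \<Longrightarrow> 0 < r \<Longrightarrow> emeasure \<nu> (ball x r) = a r"
    and a: "\<And>r. 0 < r \<Longrightarrow> 0 < a r \<and> a r < \<top>"
  shows "\<mu> = \<nu>"
proof -
  have cover: "(\<Union>n::nat. ball x0 (Suc n)) = UNIV"
    by (auto simp: mem_ball) (metis less_Suc_eq of_nat_less_iff reals_Archimedean2 order_less_trans of_nat_Suc)
  have sigma: "sigma_finite_measure \<kappa>"
    if k: "sets \<kappa> = sets borel" "\<And>r. 0 < r \<Longrightarrow> emeasure \<kappa> (ball x0 r) = a r" for \<kappa>
  proof
    show "\<exists>A. countable A \<and> A \<subseteq> sets \<kappa> \<and> \<Union>A = space \<kappa> \<and> (\<forall>a\<in>A. emeasure \<kappa> a \<noteq> \<infinity>)"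
      using cover k a sets_eq_imp_space_eq[OF k(1)]
      by (intro exI[of _ "range (\<lambda>n::nat. ball x0 (Suc n))"]) (auto simp: less_top[symmetric])
  qed
  have s: "sigma_finite_measure \<mu>" "sigma_finite_measure \<nu>"
    using S sigma[OF sets_mu ball_mu] sigma[OF sets_nu ball_nu] by auto
  have eq: "emeasure \<mu> U = emeasure \<nu> U" if "open U" for U
    using uniformly_distributed_open_le[OF sets_mu sets_nu s AE ball_mu ball_nu a that]
      uniformly_distributed_open_le[OF sets_nu sets_mu s(2,1) AE(2,1) ball_nu ball_mu a that]
    by (intro antisym) auto
  show ?thesis
  proof (rule measure_eqI_generator_eq[where E="Collect open" and \<Omega>=UNIV and A="\<lambda>n::nat. ball x0 (Suc n)"])
    show "sets \<mu> = sigma_sets UNIV (Collect open)" "sets \<nu> = sigma_sets UNIV (Collect open)"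
      by (simp_all add: sets_mu sets_nu sets_borel)
    show "emeasure \<mu> (ball x0 (real (Suc i))) \<noteq> \<infinity>" for i
      using ball_mu[OF S, of "Suc i"] a[of "Suc i"] by (auto simp: less_top)
  qed (use cover eq in \<open>auto simp: Int_stable_def\<close>)
qed

text \<open>
  An isometry permutes the balls of a given radius, and Lebesgue measure gives all of them the same mass.
\<close>

lemma distr_lborel_isometry:
  fixes T :: "'a::euclidean_space \<Rightarrow> 'a"
  assumes T: "orthogonal_transformation T"
  shows "distr lborel borel T = lborel"
proof -
  have lin: "linear T" and [simp]: "norm (T x) = norm x" for x
    using T by (auto simp: orthogonal_transformation)
  have [measurable]: "T \<in> borel_measurable borel"
    using lin by (intro borel_measurable_continuous_onI linear_continuous_on) (simp add: linear_conv_bounded_linear)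
  have inj: "bij T" using orthogonal_transformation_bij[OF T] .
  define a where "a r = emeasure lborel (ball (0::'a) r)" for r :: real
  have b: "emeasure lborel (ball x r) = a r" if "0 < r" for x :: 'a and r
    using that emeasure_ball[of r x] emeasure_ball[of r "0::'a"] by (simp add: a_def)
  have d: "dist (T x) (T y) = dist x y" for x y
    by (simp add: dist_norm linear_diff[OF lin, symmetric])
  have pre: "T -` ball x r = ball (inv T x) r" for x r
  proof -
    have "dist x (T z) = dist (inv T x) z" for z
      using d[of "inv T x" z] inj by (simp add: bij_is_surj surj_f_inv_f)
    then show ?thesis by auto
  qed
  show ?thesis
  proof (rule uniformly_distributed_unique[where S=UNIV and a=a])
    show "emeasure (distr lborel borel T) (ball x r) = a r" if "0 < r" for x r
      using that by (simp add: emeasure_distr pre b)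
    fix r :: real assume r: "0 < r"
    have "0 < measure lborel (ball (0::'a) r)" using r by (intro content_ball_pos)
    then show "0 < a r \<and> a r < \<top>"
      using r emeasure_lborel_ball_finite[of "0::'a" r] unfolding a_def
      by (auto simp: emeasure_eq_ennreal_measure less_top)
  qed (auto simp: b)
qed

section \<open>Reflection-invariant measures on a subspace\<close>

text \<open>
  Reflection in the hyperplane orthogonal to \<open>v\<close>. Division by zero makes it the identity for \<open>v = 0\<close>.
\<close>

definition reflect :: "'a::real_inner \<Rightarrow> 'a \<Rightarrow> 'a" where
  "reflect v x = x - (2 * (x \<bullet> v) / (v \<bullet> v)) *\<^sub>R v"

lemma linear_reflect: "linear (reflect v)"
  by (intro linearI) (auto simp: reflect_def inner_simps algebra_simps add_divide_distrib)

lemma inner_reflect [simp]: "reflect v x \<bullet> reflect v y = x \<bullet> y"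
proof (cases "v = 0")
  case False
  then show ?thesis
    by (simp add: reflect_def inner_diff_left inner_diff_right inner_commute field_simps)
qed (simp add: reflect_def)

lemma norm_reflect [simp]: "norm (reflect v x) = norm x"
  by (simp add: norm_eq_sqrt_inner)

lemma reflect_reflect [simp]: "reflect v (reflect v x) = x"
  by (cases "v = 0") (auto simp: reflect_def inner_simps scaleR_left_distrib[symmetric] scaleR_left_diff_distrib)

lemma orthogonal_transformation_reflect:
  "orthogonal_transformation (reflect (v :: 'a::euclidean_space))"
  by (simp add: orthogonal_transformation linear_reflect)

lemma measurable_reflect [measurable]:
  "reflect (v :: 'a::euclidean_space) \<in> borel_measurable borel"
  unfolding reflect_def by measurable

text \<open>
  This is the transitivity of reflections on spheres, on which the uniqueness of reflection-invariant measures
  rests.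
\<close>

lemma reflect_swap:
  assumes "norm x = norm y"
  shows "reflect (x - y) x = y"
proof (cases "x = y")
  case False
  have "x \<bullet> x = y \<bullet> y" using assms by (simp add: norm_eq)
  then have "(x - y) \<bullet> (x - y) = 2 * (x \<bullet> (x - y))"
    by (simp add: inner_simps inner_commute)
  moreover have "(x - y) \<bullet> (x - y) \<noteq> 0" using False by simp
  ultimately show ?thesis by (simp add: reflect_def)
qed (simp add: reflect_def)

lemma reflect_in_subspace:
  assumes "subspace L" "v \<in> L"
  shows "reflect v x \<in> L \<longleftrightarrow> x \<in> L"
proof -
  have "reflect v x \<in> L" if "x \<in> L" for x
    using assms that by (simp add: reflect_def subspace_diff subspace_scale)
  from this[of x] this[of "reflect v x"] show ?thesis by auto
qed

lemma dist_reflect: "dist (reflect v x) (reflect v y) = dist x y"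
  by (simp add: dist_norm linear_diff[OF linear_reflect, symmetric])

lemma vimage_reflect_ball: "reflect v -` ball x r = ball (reflect v x) r"
  using dist_reflect[of v "reflect v x"] by auto

text \<open>
  On the unit sphere of \<open>L\<close> a reflection-invariant measure gives all balls of one radius centred there the
  same mass, which is positive by compactness. For two probability measures these masses agree, because both equal the
  product measure of the pairs of points at distance less than \<open>r\<close>.
\<close>

theorem reflection_invariant_sphere_unique:
  fixes \<mu> \<nu> :: "'a::euclidean_space measure"
  assumes prob: "prob_space \<mu>" "prob_space \<nu>"
    and sets_mu[measurable_cong]: "sets \<mu> = sets borel" and sets_nu[measurable_cong]: "sets \<nu> = sets borel"
    and L: "subspace L"
    and AE: "AE x in \<mu>. x \<in> L \<and> norm x = 1" "AE x in \<nu>. x \<in> L \<and> norm x = 1"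
    and inv: "\<And>v. v \<in> L \<Longrightarrow> distr \<mu> borel (reflect v) = \<mu>"
             "\<And>v. v \<in> L \<Longrightarrow> distr \<nu> borel (reflect v) = \<nu>"
  shows "\<mu> = \<nu>"
proof -
  interpret mu: prob_space \<mu> by fact
  interpret nu: prob_space \<nu> by fact
  interpret pair_sigma_finite \<mu> \<nu> ..
  define S where "S = {x \<in> L. norm x = 1}"
  have "S = L \<inter> sphere 0 1" by (auto simp: S_def)
  then have S: "compact S"
    using closed_subspace[OF L] by (simp add: closed_Int_compact)
  have "\<exists>x. x \<in> S"
  proof (rule ccontr)
    assume "\<not> (\<exists>x. x \<in> S)"
    then have "AE x in \<mu>. False" by (intro eventually_mono[OF AE(1)]) (auto simp: S_def)
    then show False by simp
  qed
  then obtain x0 where x0: "x0 \<in> S" by blast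
  have const: "emeasure \<kappa> (ball x r) = emeasure \<kappa> (ball x0 r)"
    if k: "sets \<kappa> = sets borel" "\<And>v. v \<in> L \<Longrightarrow> distr \<kappa> borel (reflect v) = \<kappa>" and x: "x \<in> S" for \<kappa> x r
  proof -
    have "x - x0 \<in> L" using x x0 L by (auto simp: S_def subspace_diff)
    then have "emeasure \<kappa> (ball x r) = emeasure (distr \<kappa> borel (reflect (x - x0))) (ball x r)"
      by (simp add: k)
    also have "\<dots> = emeasure \<kappa> (reflect (x - x0) -` ball x r)"
      using k(1) sets_eq_imp_space_eq[OF k(1)] by (subst emeasure_distr) (auto simp: measurable_cong_sets[OF k(1) refl])
    also have "\<dots> = emeasure \<kappa> (ball x0 r)"
      unfolding vimage_reflect_ball using x x0 by (simp add: reflect_swap S_def)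
    finally show ?thesis .
  qed
  have pos: "0 < emeasure \<kappa> (ball x0 r)"
    if k: "sets \<kappa> = sets borel" "\<And>v. v \<in> L \<Longrightarrow> distr \<kappa> borel (reflect v) = \<kappa>"
      and p: "prob_space \<kappa>" "AE x in \<kappa>. x \<in> S" and r: "0 < r" for \<kappa> r
  proof (rule ccontr)
    assume "\<not> 0 < emeasure \<kappa> (ball x0 r)"
    then have 0: "emeasure \<kappa> (ball x r) = 0" if "x \<in> S" for x
      using const[OF k that] by simp
    interpret prob_space \<kappa> by fact
    obtain F where F: "finite F" "F \<subseteq> S" "S \<subseteq> (\<Union>x\<in>F. ball x r)"
      by (rule compactE_image[OF S, of S "\<lambda>x. ball x r"]) (use r in \<open>auto intro: centre_in_ball[THEN iffD2]\<close>)
    have "AE y in \<kappa>. \<forall>x\<in>F. y \<notin> ball x r"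
      unfolding AE_finite_all[OF F(1)]
      using F(2) 0 k(1) by (intro ballI AE_not_in) (auto simp: null_sets_def)
    then have "AE y in \<kappa>. y \<in> S \<and> (\<forall>x\<in>F. y \<notin> ball x r)"
      using p(2) by simp
    then have "AE y in \<kappa>. False"
      by (rule eventually_mono) (use F(3) in blast)
    then show False by simp
  qed
  have AE': "AE x in \<mu>. x \<in> S" "AE x in \<nu>. x \<in> S" using AE by (auto simp: S_def)
  note [simp] = mu.emeasure_space_1[simplified sets_eq_imp_space_eq[OF sets_mu] space_borel]
    nu.emeasure_space_1[simplified sets_eq_imp_space_eq[OF sets_nu] space_borel]
    sets_eq_imp_space_eq[OF sets_mu] sets_eq_imp_space_eq[OF sets_nu]
  have ab: "emeasure \<mu> (ball x0 r) = emeasure \<nu> (ball x0 r)" for r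
  proof -
    let ?k = "\<lambda>x y. indicator {z. dist (fst z) (snd z) < r} (x, y) :: ennreal"
    have [measurable]: "{z :: 'a \<times> 'a. dist (fst z) (snd z) < r} \<in> sets (borel \<Otimes>\<^sub>M borel)"
      unfolding borel_prod by (intro borel_open open_Collect_less continuous_intros)
    have 1: "(\<integral>\<^sup>+x. ?k x y \<partial>\<mu>) = emeasure \<mu> (ball y r)" for y
    proof -
      have "(\<integral>\<^sup>+x. ?k x y \<partial>\<mu>) = (\<integral>\<^sup>+x. indicator (ball y r) x \<partial>\<mu>)"
        by (intro nn_integral_cong) (auto simp: indicator_def dist_commute)
      then show ?thesis by simp
    qed
    have 2: "(\<integral>\<^sup>+y. ?k x y \<partial>\<nu>) = emeasure \<nu> (ball x r)" for x
    proof -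
      have "(\<integral>\<^sup>+y. ?k x y \<partial>\<nu>) = (\<integral>\<^sup>+y. indicator (ball x r) y \<partial>\<nu>)"
        by (intro nn_integral_cong) (auto simp: indicator_def)
      then show ?thesis by simp
    qed
    have "emeasure \<mu> (ball x0 r) = (\<integral>\<^sup>+y. emeasure \<mu> (ball x0 r) \<partial>\<nu>)" by simp
    also have "\<dots> = (\<integral>\<^sup>+y. emeasure \<mu> (ball y r) \<partial>\<nu>)"
      using AE'(2) const[OF sets_mu inv(1)] by (intro nn_integral_cong_AE) (auto elim: eventually_mono)
    also have "\<dots> = (\<integral>\<^sup>+y. \<integral>\<^sup>+x. ?k x y \<partial>\<mu> \<partial>\<nu>)" unfolding 1 ..
    also have "\<dots> = (\<integral>\<^sup>+x. \<integral>\<^sup>+y. ?k x y \<partial>\<nu> \<partial>\<mu>)"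
      by (intro Fubini') measurable
    also have "\<dots> = (\<integral>\<^sup>+x. emeasure \<nu> (ball x r) \<partial>\<mu>)" unfolding 2 ..
    also have "\<dots> = (\<integral>\<^sup>+x. emeasure \<nu> (ball x0 r) \<partial>\<mu>)"
      using AE'(1) const[OF sets_nu inv(2)] by (intro nn_integral_cong_AE) (auto elim: eventually_mono)
    also have "\<dots> = emeasure \<nu> (ball x0 r)" by simp
    finally show ?thesis .
  qed
  show ?thesis
  proof (rule uniformly_distributed_unique[OF sets_mu sets_nu AE' x0])
    show "emeasure \<mu> (ball x r) = emeasure \<mu> (ball x0 r)" if "x \<in> S" for x r
      by (rule const[OF sets_mu inv(1) that])
    show "emeasure \<nu> (ball x r) = emeasure \<mu> (ball x0 r)" if "x \<in> S" for x r
      unfolding ab by (rule const[OF sets_nu inv(2) that])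
    show "0 < emeasure \<mu> (ball x0 r) \<and> emeasure \<mu> (ball x0 r) < \<top>" if "0 < r" for r
      using pos[OF sets_mu inv(1) prob(1) AE'(1) that] by (simp add: mu.emeasure_finite less_top[symmetric])
  qed
qed

text \<open>
  Whether \<open>x\<close> belongs to a cone depends only on the direction \<open>sgn x\<close>, and the laws of the
  direction coincide.
\<close>

theorem reflection_invariant_cone_unique:
  fixes \<mu> \<nu> :: "'a::euclidean_space measure"
  assumes prob: "prob_space \<mu>" "prob_space \<nu>"
    and sets_mu[measurable_cong]: "sets \<mu> = sets borel" and sets_nu[measurable_cong]: "sets \<nu> = sets borel"
    and L: "subspace L"
    and AE: "AE x in \<mu>. x \<in> L - {0}" "AE x in \<nu>. x \<in> L - {0}"
    and inv: "\<And>v. v \<in> L \<Longrightarrow> distr \<mu> borel (reflect v) = \<mu>"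
             "\<And>v. v \<in> L \<Longrightarrow> distr \<nu> borel (reflect v) = \<nu>"
    and K[measurable]: "K \<in> sets borel" and cone: "\<And>c x. 0 < c \<Longrightarrow> x \<in> K \<Longrightarrow> c *\<^sub>R x \<in> K"
  shows "measure \<mu> K = measure \<nu> K"
proof -
  have [measurable]: "(sgn :: 'a \<Rightarrow> 'a) \<in> borel_measurable borel"
    unfolding sgn_div_norm by measurable
  have sphere: "prob_space (distr \<kappa> borel sgn) \<and> (AE x in distr \<kappa> borel sgn. x \<in> L \<and> norm x = 1)
      \<and> (\<forall>v\<in>L. distr (distr \<kappa> borel sgn) borel (reflect v) = distr \<kappa> borel sgn)
      \<and> measure \<kappa> K = measure (distr \<kappa> borel sgn) K"
    if p: "prob_space \<kappa>" and [measurable_cong]: "sets \<kappa> = sets borel" and A: "AE x in \<kappa>. x \<in> L - {0}"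
      and i: "\<And>v. v \<in> L \<Longrightarrow> distr \<kappa> borel (reflect v) = \<kappa>" for \<kappa> :: "'a measure"
  proof (intro conjI ballI)
    interpret prob_space \<kappa> by fact
    show "prob_space (distr \<kappa> borel sgn)" by (rule prob_space_distr) measurable
    have [measurable]: "L \<in> sets borel" using closed_subspace[OF L] by simp
    show "AE x in distr \<kappa> borel sgn. x \<in> L \<and> norm x = 1"
    proof (subst AE_distr_iff)
      show "AE x in \<kappa>. sgn x \<in> L \<and> norm (sgn x) = 1"
        using A by eventually_elim (simp add: norm_sgn sgn_div_norm subspace_scale[OF L])
    qed measurable
    fix v assume v: "v \<in> L"
    have "distr (distr \<kappa> borel sgn) borel (reflect v) = distr \<kappa> borel (\<lambda>x. reflect v (sgn x))"
      by (subst distr_distr) (auto simp: comp_def)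
    also have "(\<lambda>x. reflect v (sgn x)) = (\<lambda>x. sgn (reflect v x))"
      by (simp add: sgn_div_norm linear_cmul[OF linear_reflect])
    also have "distr \<kappa> borel (\<lambda>x. sgn (reflect v x)) = distr (distr \<kappa> borel (reflect v)) borel sgn"
      by (subst distr_distr) (auto simp: comp_def)
    finally show "distr (distr \<kappa> borel sgn) borel (reflect v) = distr \<kappa> borel sgn"
      by (simp add: i[OF v])
  next
    interpret prob_space \<kappa> by fact
    have K_sgn: "x \<in> K \<longleftrightarrow> sgn x \<in> K" if "x \<noteq> 0" for x
      using that cone[of "norm x" "sgn x"] cone[of "inverse (norm x)" x]
      by (auto simp: sgn_div_norm)
    have "AE x in \<kappa>. x \<in> K \<longleftrightarrow> x \<in> {x \<in> space \<kappa>. sgn x \<in> K}"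
      using A AE_space by eventually_elim (simp add: K_sgn)
    then have "measure \<kappa> K = measure \<kappa> {x \<in> space \<kappa>. sgn x \<in> K}"
      by (intro finite_measure_eq_AE) auto
    also have "\<dots> = measure (distr \<kappa> borel sgn) K"
      by (subst measure_distr) (auto intro!: arg_cong[where f="measure \<kappa>"])
    finally show "measure \<kappa> K = measure (distr \<kappa> borel sgn) K" .
  qed
  note p = sphere[OF prob(1) sets_mu AE(1) inv(1)] sphere[OF prob(2) sets_nu AE(2) inv(2)]
  have "distr \<mu> borel sgn = distr \<nu> borel sgn"
    by (rule reflection_invariant_sphere_unique[where L=L]) (use p L in auto)
  with p show ?thesis by simp
qed

section \<open>Lebesgue measure on a subspace and solid angles\<close>

lemma distr_PiM_lborel_translation:
  fixes y :: "'i \<Rightarrow> real"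
  assumes I: "finite I"
  shows "distr (\<Pi>\<^sub>M i\<in>I. lborel) (\<Pi>\<^sub>M i\<in>I. lborel) (\<lambda>x. \<lambda>i\<in>I. y i + x i) = (\<Pi>\<^sub>M i\<in>I. lborel)"
proof -
  interpret product_sigma_finite "\<lambda>_::'i. lborel :: real measure" ..
  let ?P = "\<Pi>\<^sub>M i\<in>I. (lborel :: real measure)"
  let ?s = "\<lambda>x. \<lambda>i\<in>I. y i + x i"
  have [measurable]: "?s \<in> ?P \<rightarrow>\<^sub>M ?P" by measurable
  show "distr ?P ?P ?s = ?P"
  proof (rule PiM_eqI[OF I])
    fix A :: "'i \<Rightarrow> real set" assume A: "\<And>i. i \<in> I \<Longrightarrow> A i \<in> sets lborel"
    have A': "Pi\<^sub>E I A \<in> sets ?P" using A by (intro sets_PiM_I_finite I) auto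
    have "emeasure (distr ?P ?P ?s) (Pi\<^sub>E I A) = emeasure ?P (?s -` Pi\<^sub>E I A \<inter> space ?P)"
      using A' by (intro emeasure_distr) auto
    also have "?s -` Pi\<^sub>E I A \<inter> space ?P = Pi\<^sub>E I (\<lambda>i. (+) (y i) -` A i)"
      by (auto simp: space_PiM PiE_def Pi_def extensional_def)
    also have "emeasure ?P \<dots> = (\<Prod>i\<in>I. emeasure lborel ((+) (y i) -` A i))"
      using A by (intro emeasure_PiM I) (auto intro!: measurable_sets_borel[of _ borel])
    also have "\<dots> = (\<Prod>i\<in>I. emeasure (distr lborel borel ((+) (y i))) (A i))"
      using A by (intro prod.cong refl) (simp add: emeasure_distr)
    also have "\<dots> = (\<Prod>i\<in>I. emeasure lborel (A i))" by (simp add: lborel_distr_plus)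
    finally show "emeasure (distr ?P ?P ?s) (Pi\<^sub>E I A) = (\<Prod>i\<in>I. emeasure lborel (A i))" .
  qed simp
qed

lemma orthonormal_basis_of_finite:
  assumes "orthonormal_basis_of L B"
  shows "finite B"
proof -
  have "0 \<notin> B" using assms by (auto simp: orthonormal_basis_of_def)
  then have "independent B"
    using assms by (auto simp: orthonormal_basis_of_def pairwise_orthogonal_independent)
  then show ?thesis by (rule independent_imp_finite)
qed

context
  fixes L B :: "'a::euclidean_space set"
  assumes B: "orthonormal_basis_of L B"
begin

definition basis_comb :: "('a \<Rightarrow> real) \<Rightarrow> 'a" where
  "basis_comb x = (\<Sum>b\<in>B. x b *\<^sub>R b)"

lemma finite_B: "finite B" using orthonormal_basis_of_finite[OF B] .

lemma inner_B: "b \<in> B \<Longrightarrow> c \<in> B \<Longrightarrow> b \<bullet> c = (if b = c then 1 else 0)"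
  using B by (auto simp: orthonormal_basis_of_def pairwise_def orthogonal_def norm_eq_1)

lemma inner_basis_comb: "b \<in> B \<Longrightarrow> basis_comb x \<bullet> b = x b"
  using finite_B
  by (simp add: basis_comb_def inner_sum_left inner_B if_distrib[of "(*) _"] cong: if_cong)

lemma basis_comb_mem: "basis_comb x \<in> L"
proof -
  have "basis_comb x \<in> span B" unfolding basis_comb_def by (intro span_sum span_scale span_base)
  then show ?thesis using B by (simp add: orthonormal_basis_of_def)
qed

lemma basis_comb_inner:
  assumes "y \<in> L"
  shows "basis_comb (\<lambda>b. y \<bullet> b) = y"
proof -
  have "y \<in> span B" using assms B by (simp add: orthonormal_basis_of_def)
  then obtain u where "y = basis_comb u"
    using finite_B by (auto simp: span_finite basis_comb_def)
  moreover have "basis_comb (\<lambda>b. basis_comb u \<bullet> b) = basis_comb u"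
    unfolding basis_comb_def by (intro sum.cong refl) (simp add: inner_basis_comb[unfolded basis_comb_def])
  ultimately show ?thesis by simp
qed

lemma measurable_basis_comb [measurable]: "basis_comb \<in> (\<Pi>\<^sub>M b\<in>B. lborel) \<rightarrow>\<^sub>M borel"
  unfolding basis_comb_def by measurable

lemma basis_measure_translation:
  assumes y: "y \<in> L"
  shows "distr (distr (\<Pi>\<^sub>M b\<in>B. lborel) borel basis_comb) borel (\<lambda>x. y + x) = distr (\<Pi>\<^sub>M b\<in>B. lborel) borel basis_comb"
proof -
  let ?P = "\<Pi>\<^sub>M b\<in>B. (lborel :: real measure)"
  let ?s = "\<lambda>x. \<lambda>b\<in>B. y \<bullet> b + x b"
  have shift: "distr ?P ?P ?s = ?P" by (rule distr_PiM_lborel_translation[OF finite_B])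
  have [measurable]: "?s \<in> ?P \<rightarrow>\<^sub>M ?P" by measurable
  have "distr (distr ?P borel basis_comb) borel (\<lambda>x. y + x) = distr ?P borel (\<lambda>x. y + basis_comb x)"
    by (subst distr_distr) (auto simp: comp_def)
  also have "(\<lambda>x. y + basis_comb x) = basis_comb \<circ> ?s"
  proof
    fix x
    have "y + basis_comb x = basis_comb (\<lambda>b. y \<bullet> b) + basis_comb x"
      by (simp add: basis_comb_inner[OF y])
    also have "\<dots> = (basis_comb \<circ> ?s) x"
      by (simp add: basis_comb_def sum.distrib[symmetric] scaleR_left_distrib)
    finally show "y + basis_comb x = (basis_comb \<circ> ?s) x" .
  qed
  also have "distr ?P borel (basis_comb \<circ> ?s) = distr (distr ?P ?P ?s) borel basis_comb"
    by (subst distr_distr) auto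
  also have "\<dots> = distr ?P borel basis_comb" by (simp add: shift)
  finally show ?thesis .
qed

text \<open>
  The ball lies in a cube of the coordinate space and contains a smaller one.
\<close>

lemma basis_measure_ball:
  assumes r: "0 < r"
  shows "0 < emeasure (distr (\<Pi>\<^sub>M b\<in>B. lborel) borel basis_comb) (ball 0 r)"
    and "emeasure (distr (\<Pi>\<^sub>M b\<in>B. lborel) borel basis_comb) (ball 0 r) < \<top>"
proof -
  interpret product_sigma_finite "\<lambda>_::'a. lborel :: real measure" ..
  let ?P = "\<Pi>\<^sub>M b\<in>B. (lborel :: real measure)"
  have eq: "emeasure (distr ?P borel basis_comb) (ball 0 r) = emeasure ?P (basis_comb -` ball 0 r \<inter> space ?P)"
    by (intro emeasure_distr) auto
  \<comment> \<open>The increment by 1 keeps the quotient meaningful for an empty basis and makes the triangle inequality strict.\<close>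
  define s where "s = r / (real (card B) + 1)"
  have s: "0 < s" using r by (simp add: s_def)
  have "0 < (\<Prod>b\<in>B. emeasure lborel {-s<..<s})" using s by (simp add: prod_constant ennreal_power)
  also have "\<dots> = emeasure ?P (Pi\<^sub>E B (\<lambda>_. {-s<..<s}))"
    by (intro emeasure_PiM[symmetric] finite_B) auto
  also have "\<dots> \<le> emeasure ?P (basis_comb -` ball 0 r \<inter> space ?P)"
  proof (rule emeasure_mono)
    show "basis_comb -` ball 0 r \<inter> space ?P \<in> sets ?P" by measurable
    show "Pi\<^sub>E B (\<lambda>_. {-s<..<s}) \<subseteq> basis_comb -` ball 0 r \<inter> space ?P"
    proof
      fix x assume x: "x \<in> Pi\<^sub>E B (\<lambda>_. {-s<..<s})"
      have "norm (basis_comb x) \<le> (\<Sum>b\<in>B. norm (x b *\<^sub>R b))"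
        unfolding basis_comb_def by (rule norm_sum)
      also have "\<dots> \<le> (\<Sum>b\<in>B. s)"
        using x B by (intro sum_mono) (auto simp: orthonormal_basis_of_def PiE_def Pi_def abs_le_iff intro: less_imp_le dest!: bspec)
      also have "\<dots> = real (card B) * s" by simp
      also have "\<dots> < (real (card B) + 1) * s" using s by simp
      also have "\<dots> = r" by (simp add: s_def)
      finally show "x \<in> basis_comb -` ball 0 r \<inter> space ?P"
        using x by (auto simp: space_PiM PiE_def)
    qed
  qed
  finally show "0 < emeasure (distr ?P borel basis_comb) (ball 0 r)" unfolding eq .
  have "emeasure ?P (basis_comb -` ball 0 r \<inter> space ?P) \<le> emeasure ?P (Pi\<^sub>E B (\<lambda>_. {-r..r}))"
  proof (rule emeasure_mono)
    show "Pi\<^sub>E B (\<lambda>_. {-r..r}) \<in> sets ?P" by (intro sets_PiM_I_finite finite_B) auto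
    show "basis_comb -` ball 0 r \<inter> space ?P \<subseteq> Pi\<^sub>E B (\<lambda>_. {-r..r})"
    proof
      fix x assume x: "x \<in> basis_comb -` ball 0 r \<inter> space ?P"
      have "\<bar>x b\<bar> \<le> r" if b: "b \<in> B" for b
      proof -
        have "\<bar>basis_comb x \<bullet> b\<bar> \<le> norm (basis_comb x) * norm b" by (rule Cauchy_Schwarz_ineq2)
        with x b B show ?thesis by (simp add: inner_basis_comb orthonormal_basis_of_def)
      qed
      then show "x \<in> Pi\<^sub>E B (\<lambda>_. {-r..r})" using x by (auto simp: space_PiM PiE_def Pi_def abs_le_iff minus_le_iff)
    qed
  qed
  also have "\<dots> = (\<Prod>b\<in>B. emeasure lborel {-r..r})" by (intro emeasure_PiM finite_B) auto
  also have "\<dots> < \<top>" using r by (simp add: power_less_top_ennreal)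
  finally show "emeasure (distr ?P borel basis_comb) (ball 0 r) < \<top>" unfolding eq .
qed

lemma basis_measure_zero:
  assumes "B \<noteq> {}"
  shows "emeasure (distr (\<Pi>\<^sub>M b\<in>B. lborel) borel basis_comb) {0} = 0"
proof -
  interpret product_sigma_finite "\<lambda>_::'a. lborel :: real measure" ..
  let ?P = "\<Pi>\<^sub>M b\<in>B. (lborel :: real measure)"
  have "emeasure (distr ?P borel basis_comb) {0} = emeasure ?P (basis_comb -` {0} \<inter> space ?P)"
    by (intro emeasure_distr) auto
  also have "\<dots> \<le> emeasure ?P (Pi\<^sub>E B (\<lambda>_. {0::real}))"
  proof (rule emeasure_mono)
    show "Pi\<^sub>E B (\<lambda>_. {0}) \<in> sets ?P" by (intro sets_PiM_I_finite finite_B) auto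
    show "basis_comb -` {0} \<inter> space ?P \<subseteq> Pi\<^sub>E B (\<lambda>_. {0})"
    proof
      fix x assume x: "x \<in> basis_comb -` {0} \<inter> space ?P"
      then have "x b = 0" if "b \<in> B" for b using inner_basis_comb[OF that, of x] by simp
      with x show "x \<in> Pi\<^sub>E B (\<lambda>_. {0})" by (intro PiE_I) (auto simp: space_PiM PiE_def extensional_def)
    qed
  qed
  also have "\<dots> = (\<Prod>b\<in>B. emeasure lborel {0::real})" by (intro emeasure_PiM finite_B) auto
  also have "\<dots> = 0" using assms finite_B by (simp add: prod_constant card_gt_0_iff)
  finally show ?thesis by simp
qed

end

lemma subspace_lborel_properties:
  fixes L :: "'a::euclidean_space set"
  assumes L: "subspace L"
  shows sets_subspace_lborel: "sets (subspace_lborel L) = sets borel"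
    and AE_subspace_lborel: "AE x in subspace_lborel L. x \<in> L"
    and subspace_lborel_translation: "y \<in> L \<Longrightarrow> distr (subspace_lborel L) borel (\<lambda>x. y + x) = subspace_lborel L"
    and subspace_lborel_ball_pos: "0 < r \<Longrightarrow> 0 < emeasure (subspace_lborel L) (ball 0 r)"
    and subspace_lborel_ball_finite: "0 < r \<Longrightarrow> emeasure (subspace_lborel L) (ball 0 r) < \<top>"
    and subspace_lborel_zero: "L \<noteq> {0} \<Longrightarrow> emeasure (subspace_lborel L) {0} = 0"
proof -
  define B where "B = (SOME B. orthonormal_basis_of L B)"
  have B: "orthonormal_basis_of L B"
    unfolding B_def by (rule someI_ex) (rule orthonormal_basis_of_exists[OF L])
  have eq: "subspace_lborel L = distr (\<Pi>\<^sub>M b\<in>B. lborel) borel (basis_comb B)"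
    by (simp add: subspace_lborel_def B_def[symmetric] Let_def basis_comb_def[OF B, abs_def])
  show "sets (subspace_lborel L) = sets borel" by (simp add: eq)
  have [measurable]: "L \<in> sets borel" using closed_subspace[OF L] by simp
  show "AE x in subspace_lborel L. x \<in> L"
    unfolding eq by (subst AE_distr_iff) (auto simp: measurable_basis_comb[OF B] basis_comb_mem[OF B])
  show "distr (subspace_lborel L) borel (\<lambda>x. y + x) = subspace_lborel L" if "y \<in> L"
    unfolding eq by (rule basis_measure_translation[OF B that])
  show "0 < emeasure (subspace_lborel L) (ball 0 r)" "emeasure (subspace_lborel L) (ball 0 r) < \<top>" if "0 < r"
    unfolding eq by (rule basis_measure_ball[OF B that])+
  show "emeasure (subspace_lborel L) {0} = 0" if "L \<noteq> {0}"
    unfolding eq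
  proof (rule basis_measure_zero[OF B])
    show "B \<noteq> {}" using B that by (auto simp: orthonormal_basis_of_def)
  qed
qed

text \<open>
  Translation invariance along \<open>L\<close> makes the mass of a ball centred on \<open>L\<close> depend on its radius only,
  and a reflection along a vector of \<open>L\<close> permutes these balls. The arbitrary choice of an orthonormal basis of
  \<open>L\<close> thus leaves no trace.
\<close>

lemma distr_subspace_lborel_reflect:
  fixes L :: "'a::euclidean_space set"
  assumes L: "subspace L" and v: "v \<in> L"
  shows "distr (subspace_lborel L) borel (reflect v) = subspace_lborel L"
proof -
  note [measurable_cong] = sets_subspace_lborel[OF L]
  have [simp]: "space (subspace_lborel L) = UNIV"
    using sets_eq_imp_space_eq[OF sets_subspace_lborel[OF L]] by simp
  have [measurable]: "L \<in> sets borel" using closed_subspace[OF L] by simp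
  define a where "a r = emeasure (subspace_lborel L) (ball 0 r)" for r
  have ball: "emeasure (subspace_lborel L) (ball x r) = a r" if "x \<in> L" for x r
  proof -
    have "emeasure (subspace_lborel L) (ball x r) = emeasure (distr (subspace_lborel L) borel (\<lambda>y. x + y)) (ball x r)"
      by (simp add: subspace_lborel_translation[OF L that])
    also have "\<dots> = emeasure (subspace_lborel L) ((\<lambda>y. x + y) -` ball x r)"
      by (subst emeasure_distr) auto
    also have "(\<lambda>y. x + y) -` ball x r = ball 0 r" by (auto simp: dist_norm)
    finally show ?thesis by (simp add: a_def)
  qed
  show ?thesis
  proof (rule uniformly_distributed_unique[where S=L and a=a and ?x0.0=0])
    show "AE x in distr (subspace_lborel L) borel (reflect v). x \<in> L"
      using AE_subspace_lborel[OF L] by (subst AE_distr_iff) (auto simp: reflect_in_subspace[OF L v])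
    show "emeasure (distr (subspace_lborel L) borel (reflect v)) (ball x r) = a r" if "x \<in> L" for x r
      using that by (simp add: emeasure_distr vimage_reflect_ball ball reflect_in_subspace[OF L v])
    show "0 < a r \<and> a r < \<top>" if "0 < r" for r
      using that subspace_lborel_ball_pos[OF L] subspace_lborel_ball_finite[OF L] by (simp add: a_def)
  qed (use L in \<open>auto simp: sets_subspace_lborel AE_subspace_lborel ball subspace_0\<close>)
qed

text \<open>
  The solid angle is the probability of the cone under the uniform distribution on the unit ball of its linear hull,
  which is the form in which the uniqueness theorem for cones applies to it.
\<close>

lemma solid_angle_uniform:
  fixes C L :: "'a::euclidean_space set"
  assumes span: "span C = L" and L0: "L \<noteq> {0}"
  defines "U \<equiv> uniform_measure (subspace_lborel L) (cball 0 1)"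
  shows "C \<in> sets borel \<Longrightarrow> solid_angle C = measure U C"
    and "prob_space U" and "sets U = sets borel" and "AE x in U. x \<in> L - {0}"
    and "v \<in> L \<Longrightarrow> distr U borel (reflect v) = U"
proof -
  have L: "subspace L" using span by (metis subspace_span)
  note S[measurable_cong] = sets_subspace_lborel[OF L]
  let ?S = "subspace_lborel L"
  have sp [simp]: "space ?S = UNIV" using sets_eq_imp_space_eq[OF S] by simp
  have [measurable]: "L \<in> sets borel" using closed_subspace[OF L] by simp
  have cb[measurable]: "cball 0 1 \<in> sets ?S" by (simp add: S)
  have "emeasure ?S (ball 0 1) \<le> emeasure ?S (cball 0 1)"
    by (intro emeasure_mono cb) auto
  then have pos: "emeasure ?S (cball 0 1) \<noteq> 0"
    using subspace_lborel_ball_pos[OF L, of 1] by auto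
  have "emeasure ?S (cball 0 1) \<le> emeasure ?S (ball 0 2)"
    by (intro emeasure_mono) (auto simp: S)
  then have fin: "emeasure ?S (cball 0 1) \<noteq> \<infinity>"
    using subspace_lborel_ball_finite[OF L, of 2] by (auto simp: top_unique)
  show "prob_space U" unfolding U_def by (rule prob_space_uniform_measure[OF pos fin])
  show setsU: "sets U = sets borel" by (simp add: U_def S)
  have "measure ?S (cball 0 1 \<inter> L) = measure ?S (cball 0 1)"
    using AE_subspace_lborel[OF L] by (intro measure_eq_AE) (auto simp: S elim: eventually_mono)
  then show "solid_angle C = measure U C" if "C \<in> sets borel"
    using that unfolding solid_angle_def span U_def
    by (subst measure_uniform_measure[OF pos fin]) (auto simp: S)
  have "AE x in ?S. x \<noteq> 0"
    using subspace_lborel_zero[OF L L0] by (intro AE_I[of _ _ "{0}"]) (auto simp: S)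
  with AE_subspace_lborel[OF L] have "AE x in ?S. x \<in> L - {0}" by eventually_elim auto
  then show "AE x in U. x \<in> L - {0}"
    unfolding U_def by (intro AE_uniform_measureI[OF cb]) auto
  assume v: "v \<in> L"
  show "distr U borel (reflect v) = U"
  proof (rule measure_eqI)
    show "sets (distr U borel (reflect v)) = sets U" by (simp add: setsU)
    fix A assume "A \<in> sets (distr U borel (reflect v))"
    then have A[measurable]: "A \<in> sets borel" by simp
    have [measurable]: "reflect v \<in> U \<rightarrow>\<^sub>M borel" by (simp add: measurable_cong_sets[OF setsU refl])
    have R[measurable]: "reflect v -` A \<in> sets borel"
      using measurable_sets_borel[OF measurable_reflect A] by simp
    have "emeasure (distr U borel (reflect v)) A = emeasure U (reflect v -` A)"
      by (subst emeasure_distr) (auto simp: U_def)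
    also have "\<dots> = emeasure ?S (cball 0 1 \<inter> reflect v -` A) / emeasure ?S (cball 0 1)"
      unfolding U_def by (rule emeasure_uniform_measure) (auto simp: S)
    also have "cball 0 1 \<inter> reflect v -` A = reflect v -` (cball 0 1 \<inter> A)" by auto
    also have "emeasure ?S \<dots> = emeasure (distr ?S borel (reflect v)) (cball 0 1 \<inter> A)"
      by (subst emeasure_distr) auto
    also have "\<dots> = emeasure ?S (cball 0 1 \<inter> A)" by (simp add: distr_subspace_lborel_reflect[OF L v])
    also have "\<dots> / emeasure ?S (cball 0 1) = emeasure U A"
      unfolding U_def by (rule emeasure_uniform_measure[symmetric]) (auto simp: S)
    finally show "emeasure (distr U borel (reflect v)) A = emeasure U A" .
  qed
qed

section \<open>The normal distribution function on the imaginary axis\<close>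

lemma half_gaussian_integral:
  "has_bochner_integral lborel (\<lambda>y::real. indicator {0..} y *\<^sub>R exp (- y\<^sup>2 / 2)) (sqrt (2 * pi) / 2)"
proof -
  have "has_bochner_integral lborel (\<lambda>y::real. indicator {0..} (0 + y / sqrt 2) *\<^sub>R exp (- (0 + y / sqrt 2)\<^sup>2)) ((sqrt pi / 2) /\<^sub>R \<bar>1 / sqrt 2\<bar>)"
    using gaussian_moment_0
    by (subst (asm) lborel_has_bochner_integral_real_affine_iff[where c="1 / sqrt 2" and t=0]) auto
  moreover have "indicator {0..} (0 + y / sqrt 2) *\<^sub>R exp (- (0 + y / sqrt 2)\<^sup>2) = indicator {0..} y *\<^sub>R exp (- y\<^sup>2 / 2)" for y :: real
    by (simp add: power_divide indicator_def zero_le_divide_iff)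
  moreover have "(sqrt pi / 2) /\<^sub>R \<bar>1 / sqrt 2\<bar> = sqrt (2 * pi) / 2"
    by (simp add: real_sqrt_mult)
  ultimately show ?thesis by simp
qed

text \<open>
  The segment integral that defines \<open>Phi\<close> is evaluated by an entire primitive of the Gaussian. The oddness of
  that primitive gives \<open>Phi (- z) = 1 - Phi z\<close>.
\<close>

lemma Phi_primitive:
  obtains F where "\<And>z. (F has_field_derivative exp (- z\<^sup>2 / 2)) (at z)"
    and "F 0 = 0" and "\<And>z. F (- z) = - F z"
    and "\<And>z. Phi z = 1 / 2 + F z / complex_of_real (sqrt (2 * pi))"
proof -
  have "(\<lambda>z::complex. exp (- z\<^sup>2 / 2)) holomorphic_on UNIV"
    by (intro holomorphic_intros) auto
  from holomorphic_convex_primitive'[OF convex_UNIV open_UNIV this]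
  obtain F0 where F0: "\<And>z::complex. (F0 has_field_derivative exp (- z\<^sup>2 / 2)) (at z)"
    by (metis UNIV_I)
  define F where "F z = F0 z - F0 0" for z
  have F: "(F has_field_derivative exp (- z\<^sup>2 / 2)) (at z)" for z
    unfolding F_def using DERIV_diff[OF F0 DERIV_const] by simp
  have "contour_integral (linepath 0 z) (\<lambda>t. exp (- t\<^sup>2 / 2)) = F z" for z
  proof -
    have "((\<lambda>t. exp (- t\<^sup>2 / 2)) has_contour_integral (F0 (pathfinish (linepath 0 z)) - F0 (pathstart (linepath 0 z)))) (linepath 0 z)"
      by (rule contour_integral_primitive[of UNIV, OF _ valid_path_linepath]) (use F0 in auto)
    then show ?thesis by (simp add: F_def contour_integral_unique)
  qed
  then have P: "Phi z = 1 / 2 + F z / complex_of_real (sqrt (2 * pi))" for z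
    by (simp add: Phi_def)
  have "\<exists>c. \<forall>z\<in>UNIV. F z + F (- z) = c"
  proof (rule has_field_derivative_zero_constant)
    show "((\<lambda>z. F z + F (- z)) has_field_derivative 0) (at z within UNIV)" for z
      by (rule derivative_eq_intros refl F DERIV_chain'[OF _ F] | simp)+
  qed simp
  then obtain c where c: "F z + F (- z) = c" for z by auto
  from c[of 0] have "c = 0" by (simp add: F_def)
  then have "F (- z) = - F z" for z using c[of z] by (simp add: eq_neg_iff_add_eq_0 add.commute)
  with F P show thesis by (intro that[of F]) (auto simp: F_def)
qed

lemma continuous_on_Phi: "continuous_on UNIV Phi"
proof -
  obtain F where F: "\<And>z. (F has_field_derivative exp (- z\<^sup>2 / 2)) (at z)"
    and P: "\<And>z. Phi z = 1 / 2 + F z / complex_of_real (sqrt (2 * pi))"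
    using Phi_primitive by metis
  have "continuous_on UNIV F"
    by (intro continuous_at_imp_continuous_on ballI DERIV_isCont[OF F])
  then show ?thesis unfolding P[abs_def] by (intro continuous_intros) auto
qed

text \<open>
  Completing the square turns the integrand into \<open>exp (- x\<^sup>2 / 2)\<close> times the Gaussian along the line
  \<open>Im z = - x\<close>. With a primitive \<open>F\<close>, the integral up to \<open>R\<close> is a difference of values of
  \<open>F\<close> at \<open>R - \<i> x\<close> and \<open>- \<i> x\<close>. As \<open>R\<close> grows, the Gaussian decays on the vertical segment
  from \<open>R\<close> to \<open>R - \<i> x\<close>, so the limit at \<open>R - \<i> x\<close> is the one along the real axis.
\<close>

lemma half_line_fourier_Phi:
  fixes x :: real
  defines "g \<equiv> (\<lambda>y. indicator {0..} y *\<^sub>R (complex_of_real (exp (- y\<^sup>2 / 2)) * iexp (x * y)))"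
  shows "integrable lborel g"
    and "integral\<^sup>L lborel g = complex_of_real (sqrt (2 * pi) * exp (- x\<^sup>2 / 2)) * Phi (\<i> * complex_of_real x)"
proof -
  obtain F where F: "\<And>z. (F has_field_derivative exp (- z\<^sup>2 / 2)) (at z)" and F0: "F 0 = 0"
    and odd: "\<And>z. F (- z) = - F z" and P: "\<And>z. Phi z = 1 / 2 + F z / complex_of_real (sqrt (2 * pi))"
    using Phi_primitive by metis
  have int0: "integrable lborel (\<lambda>y::real. indicator {0..} y *\<^sub>R exp (- y\<^sup>2 / 2))"
    and val0: "(\<integral>y. indicator {0..} y *\<^sub>R exp (- y\<^sup>2 / 2) \<partial>lborel) = sqrt (2 * pi) / 2"
    using half_gaussian_integral by (auto simp: has_bochner_integral_iff)
  have int: "integrable lborel (\<lambda>y. indicator {0..} y *\<^sub>R (complex_of_real (exp (- y\<^sup>2 / 2)) * iexp (u * y)))" for u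
    by (rule Bochner_Integration.integrable_bound[OF int0])
       (auto simp: norm_mult indicator_def)
  then show "integrable lborel g" by (simp add: g_def)
  \<comment> \<open>Stated for every frequency \<open>u\<close>, since \<open>u = 0\<close> yields the limit of \<open>F\<close> along the real axis.\<close>
  have lim: "((\<lambda>R. complex_of_real (exp (- u\<^sup>2 / 2)) * (F (complex_of_real R - \<i> * u) - F (- (\<i> * u))))
      \<longlongrightarrow> (\<integral>y. indicator {0..} y *\<^sub>R (complex_of_real (exp (- y\<^sup>2 / 2)) * iexp (u * y)) \<partial>lborel)) at_top" for u
  proof (rule tendsto_cong[THEN iffD1, OF _ tendsto_integral_at_top[OF _ int]])
    show "eventually (\<lambda>R. (\<integral>y. indicator {..R} y *\<^sub>R (indicator {0..} y *\<^sub>R (complex_of_real (exp (- y\<^sup>2 / 2)) * iexp (u * y))) \<partial>lborel)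
      = complex_of_real (exp (- u\<^sup>2 / 2)) * (F (complex_of_real R - \<i> * u) - F (- (\<i> * u)))) at_top"
      using eventually_ge_at_top[of 0]
    proof eventually_elim
      case (elim R)
      let ?e = "complex_of_real (exp (- u\<^sup>2 / 2))"
      have "(\<integral>y. indicator {..R} y *\<^sub>R (indicator {0..} y *\<^sub>R (complex_of_real (exp (- y\<^sup>2 / 2)) * iexp (u * y))) \<partial>lborel)
         = (\<integral>y. indicator {0..R} y *\<^sub>R (complex_of_real (exp (- y\<^sup>2 / 2)) * iexp (u * y)) \<partial>lborel)"
        by (intro Bochner_Integration.integral_cong refl) (auto simp: indicator_def)
      also have "\<dots> = ?e * F (complex_of_real R - \<i> * u) - ?e * F (complex_of_real 0 - \<i> * u)"
      proof (rule integral_FTC_atLeastAtMost[OF elim])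
        fix y
        have "((\<lambda>z. ?e * F (z - \<i> * u)) has_field_derivative ?e * exp (- (complex_of_real y - \<i> * u)\<^sup>2 / 2)) (at (complex_of_real y))"
          by (rule derivative_eq_intros refl DERIV_chain'[OF _ F] | simp)+
        also have "?e * exp (- (complex_of_real y - \<i> * u)\<^sup>2 / 2) = complex_of_real (exp (- y\<^sup>2 / 2)) * iexp (u * y)"
          unfolding exp_of_real[symmetric] exp_add[symmetric]
          by (intro arg_cong[of _ _ exp]) (simp add: power2_eq_square field_simps)
        finally show "((\<lambda>y. ?e * F (complex_of_real y - \<i> * u)) has_vector_derivative
            complex_of_real (exp (- y\<^sup>2 / 2)) * iexp (u * y)) (at y within {0..R})"
          by (rule has_vector_derivative_real_field)
      qed (intro continuous_intros, simp)
      finally show ?case by (simp add: algebra_simps)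
    qed
  qed simp
  have lim0: "((\<lambda>R. F (complex_of_real R)) \<longlongrightarrow> complex_of_real (sqrt (2 * pi) / 2)) at_top"
  proof -
    have "(\<integral>y. indicator {0..} y *\<^sub>R (complex_of_real (exp (- y\<^sup>2 / 2)) * iexp (0 * y)) \<partial>lborel)
       = (\<integral>y. complex_of_real (indicator {0..} y *\<^sub>R exp (- y\<^sup>2 / 2)) \<partial>lborel)"
      by (intro Bochner_Integration.integral_cong refl) (simp add: scaleR_conv_of_real)
    also have "\<dots> = complex_of_real (sqrt (2 * pi) / 2)"
      unfolding integral_complex_of_real val0 ..
    finally show ?thesis using lim[of 0] unfolding F0 by (simp only:) (simp add: F0)
  qed
  have "((\<lambda>R. F (complex_of_real R - \<i> * x) - F (complex_of_real R)) \<longlongrightarrow> 0) at_top"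
  proof (rule Lim_null_comparison)
    show "eventually (\<lambda>R. norm (F (complex_of_real R - \<i> * x) - F (complex_of_real R)) \<le> exp ((x\<^sup>2 - R\<^sup>2) / 2) * \<bar>x\<bar>) at_top"
    proof (intro always_eventually allI)
      fix R :: real
      let ?S = "closed_segment (complex_of_real R) (complex_of_real R - \<i> * x)"
      have "norm (F (complex_of_real R - \<i> * x) - F (complex_of_real R)) \<le> exp ((x\<^sup>2 - R\<^sup>2) / 2) * norm (complex_of_real R - \<i> * x - complex_of_real R)"
      proof (rule field_differentiable_bound[of ?S])
        show "(F has_field_derivative exp (- z\<^sup>2 / 2)) (at z within ?S)" for z
          by (rule has_field_derivative_at_within[OF F])
        fix z assume "z \<in> ?S"
        then obtain t where t: "0 \<le> t" "t \<le> 1" "z = (1 - t) *\<^sub>R complex_of_real R + t *\<^sub>R (complex_of_real R - \<i> * x)"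
          by (auto simp: in_segment)
        have "Re z = R" "Im z = - (t * x)" by (simp_all add: t(3) algebra_simps)
        moreover have "t\<^sup>2 * x\<^sup>2 \<le> 1 * x\<^sup>2" using t by (intro mult_right_mono) (auto simp: power_le_one)
        moreover have "Re (- z\<^sup>2 / 2) = - Re (z\<^sup>2) / 2" by simp
        then have "Re (- z\<^sup>2 / 2) = ((Im z)\<^sup>2 - (Re z)\<^sup>2) / 2" by (simp add: Re_power2)
        ultimately have "Re (- z\<^sup>2 / 2) \<le> (x\<^sup>2 - R\<^sup>2) / 2" by (simp add: power_mult_distrib)
        then show "norm (exp (- z\<^sup>2 / 2)) \<le> exp ((x\<^sup>2 - R\<^sup>2) / 2)" by (simp add: norm_exp_eq_Re)
      qed auto
      then show "norm (F (complex_of_real R - \<i> * x) - F (complex_of_real R)) \<le> exp ((x\<^sup>2 - R\<^sup>2) / 2) * \<bar>x\<bar>"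
        by (simp add: norm_mult)
    qed
    show "((\<lambda>R. exp ((x\<^sup>2 - R\<^sup>2) / 2) * \<bar>x\<bar>) \<longlongrightarrow> 0) at_top" by real_asymp
  qed
  from tendsto_add[OF this lim0]
  have "((\<lambda>R. F (complex_of_real R - \<i> * x)) \<longlongrightarrow> complex_of_real (sqrt (2 * pi) / 2)) at_top" by simp
  then have "((\<lambda>R. complex_of_real (exp (- x\<^sup>2 / 2)) * (F (complex_of_real R - \<i> * x) - F (- (\<i> * x))))
      \<longlongrightarrow> complex_of_real (exp (- x\<^sup>2 / 2)) * (complex_of_real (sqrt (2 * pi) / 2) - F (- (\<i> * x)))) at_top"
    by (intro tendsto_intros)
  from tendsto_unique[OF _ lim this]
  have "integral\<^sup>L lborel g = complex_of_real (exp (- x\<^sup>2 / 2)) * (complex_of_real (sqrt (2 * pi) / 2) + F (\<i> * x))"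
    by (simp add: g_def odd)
  also have "\<dots> = complex_of_real (sqrt (2 * pi) * exp (- x\<^sup>2 / 2)) * Phi (\<i> * complex_of_real x)"
    by (simp add: P field_simps)
  finally show "integral\<^sup>L lborel g = complex_of_real (sqrt (2 * pi) * exp (- x\<^sup>2 / 2)) * Phi (\<i> * complex_of_real x)" .
qed

section \<open>Gaussian vectors whose coordinates exceed their mean\<close>

text \<open>
  The factor \<open>exp (- (\<Sum>i\<in>I. y i)\<^sup>2 / 2)\<close> couples the coordinates. It is the characteristic function of the
  standard normal law at \<open>\<Sum>i\<in>I. y i\<close>, and exchanging the integrals makes the inner one a product over the
  coordinates.
\<close>

lemma orthant_gaussian_integral:
  fixes I :: "'i set"
  assumes I: "finite I"
  defines "k \<equiv> (\<lambda>y. (\<Prod>i\<in>I. indicator {0..} (y i) * exp (- (y i)\<^sup>2 / 2)) * exp (- (\<Sum>i\<in>I. y i)\<^sup>2 / 2) :: real)"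
  shows "integrable (\<Pi>\<^sub>M i\<in>I. lborel) k"
    and "complex_of_real (\<integral>y. k y \<partial>(\<Pi>\<^sub>M i\<in>I. lborel))
      = (\<integral>x. (complex_of_real (sqrt (2 * pi) * exp (- x\<^sup>2 / 2)) * Phi (\<i> * complex_of_real x)) ^ card I \<partial>std_normal_distribution)"
proof -
  interpret product_sigma_finite "\<lambda>_::'i. lborel :: real measure" ..
  let ?P = "\<Pi>\<^sub>M i\<in>I. (lborel :: real measure)"
  interpret P: finite_product_sigma_finite "\<lambda>_::'i. lborel :: real measure" I by standard (rule I)
  interpret N: prob_space std_normal_distribution by (rule prob_space_normal_density) simp
  interpret pair_sigma_finite ?P std_normal_distribution ..
  define w :: "('i \<Rightarrow> real) \<Rightarrow> real" where "w y = (\<Prod>i\<in>I. indicator {0..} (y i) * exp (- (y i)\<^sup>2 / 2))" for y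
  have w0: "0 \<le> w y" for y by (auto simp: w_def intro!: prod_nonneg)
  have intw: "integrable ?P w"
    unfolding w_def using half_gaussian_integral I
    by (intro product_integrable_prod) (auto simp: has_bochner_integral_iff)
  have [measurable]: "w \<in> borel_measurable ?P" using intw by simp
  have k_w: "k y = w y * exp (- (\<Sum>i\<in>I. y i)\<^sup>2 / 2)" for y by (simp add: k_def w_def)
  show "integrable ?P k"
    by (rule Bochner_Integration.integrable_bound[OF intw])
       (auto simp: k_w[abs_def] abs_mult w0 intro!: mult_left_le)
  define Fk :: "('i \<Rightarrow> real) \<Rightarrow> real \<Rightarrow> complex" where "Fk y x = complex_of_real (w y) * iexp ((\<Sum>i\<in>I. y i) * x)" for y x
  have norm_Fk: "norm (Fk y x) = w y" for y x by (simp add: Fk_def norm_mult w0)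
  have meas [measurable]: "case_prod Fk \<in> borel_measurable (?P \<Otimes>\<^sub>M std_normal_distribution)"
    unfolding Fk_def case_prod_beta' by measurable
  have intF: "integrable (?P \<Otimes>\<^sub>M std_normal_distribution) (case_prod Fk)"
  proof (rule Fubini_integrable[OF meas])
    show "integrable ?P (\<lambda>y. \<integral>x. norm (case_prod Fk (y, x)) \<partial>std_normal_distribution)"
      using intw N.prob_space by (simp add: norm_Fk)
    show "AE y in ?P. integrable std_normal_distribution (\<lambda>x. case_prod Fk (y, x))"
    proof (rule AE_I2)
      fix y
      have [measurable]: "(\<lambda>x. Fk y x) \<in> borel_measurable borel" unfolding Fk_def by measurable
      show "integrable std_normal_distribution (\<lambda>x. case_prod Fk (y, x))"
        by (rule N.integrable_const_bound[of _ "w y"]) (auto simp: norm_Fk)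
    qed
  qed
  have "complex_of_real (k y) = (\<integral>x. Fk y x \<partial>std_normal_distribution)" for y
  proof -
    have "(\<integral>x. Fk y x \<partial>std_normal_distribution) = complex_of_real (w y) * char std_normal_distribution (\<Sum>i\<in>I. y i)"
      unfolding Fk_def char_def by simp
    then show ?thesis by (simp add: char_std_normal_distribution k_w)
  qed
  then have "complex_of_real (\<integral>y. k y \<partial>?P) = (\<integral>y. \<integral>x. Fk y x \<partial>std_normal_distribution \<partial>?P)"
    unfolding integral_complex_of_real[symmetric] by simp
  also have "\<dots> = (\<integral>x. \<integral>y. Fk y x \<partial>?P \<partial>std_normal_distribution)"
    by (rule Fubini_integral[symmetric]) (rule intF)
  also have "\<dots> = (\<integral>x. (complex_of_real (sqrt (2 * pi) * exp (- x\<^sup>2 / 2)) * Phi (\<i> * complex_of_real x)) ^ card I \<partial>std_normal_distribution)"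
  proof (intro Bochner_Integration.integral_cong refl)
    fix x
    have "Fk y x = (\<Prod>i\<in>I. indicator {0..} (y i) *\<^sub>R (complex_of_real (exp (- (y i)\<^sup>2 / 2)) * iexp (x * y i)))" for y
    proof -
      have "iexp ((\<Sum>i\<in>I. y i) * x) = (\<Prod>i\<in>I. iexp (x * y i))"
        using I by (simp add: exp_sum[symmetric] sum_distrib_left sum_distrib_right mult_ac)
      moreover have "complex_of_real (w y) = (\<Prod>i\<in>I. complex_of_real (indicator {0..} (y i)) * complex_of_real (exp (- (y i)\<^sup>2 / 2)))"
        by (simp add: w_def)
      ultimately show ?thesis
        by (simp add: Fk_def prod.distrib[symmetric] scaleR_conv_of_real mult.assoc)
    qed
    then have "(\<integral>y. Fk y x \<partial>?P) = (\<integral>y. (\<Prod>i\<in>I. indicator {0..} (y i) *\<^sub>R (complex_of_real (exp (- (y i)\<^sup>2 / 2)) * iexp (x * y i))) \<partial>?P)"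
      by (simp only:)
    also have "\<dots> = (\<Prod>i\<in>I. \<integral>s. indicator {0..} s *\<^sub>R (complex_of_real (exp (- s\<^sup>2 / 2)) * iexp (x * s)) \<partial>lborel)"
      by (rule product_integral_prod[OF I half_line_fourier_Phi(1)])
    finally show "(\<integral>y. Fk y x \<partial>?P) = (complex_of_real (sqrt (2 * pi) * exp (- x\<^sup>2 / 2)) * Phi (\<i> * complex_of_real x)) ^ card I"
      by (simp only: half_line_fourier_Phi(2) prod_constant)
  qed
  finally show "complex_of_real (\<integral>y. k y \<partial>?P)
      = (\<integral>x. (complex_of_real (sqrt (2 * pi) * exp (- x\<^sup>2 / 2)) * Phi (\<i> * complex_of_real x)) ^ card I \<partial>std_normal_distribution)" .
qed

definition std_gauss :: "'a::euclidean_space measure" where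
  "std_gauss = density lborel (\<lambda>x. ennreal (std_gauss_density x))"

lemma std_gauss_density_nonneg [simp]: "0 \<le> std_gauss_density x"
  by (simp add: std_gauss_density_def)

lemma measurable_std_gauss_density [measurable]: "std_gauss_density \<in> borel_measurable borel"
  unfolding std_gauss_density_def[abs_def] by measurable

lemma sets_std_gauss [simp, measurable_cong]: "sets std_gauss = sets borel"
  and space_std_gauss [simp]: "space std_gauss = UNIV"
  by (simp_all add: std_gauss_def)

lemma norm_power2_sum_Basis: "(norm (x :: 'a::euclidean_space))\<^sup>2 = (\<Sum>b\<in>Basis. (x \<bullet> b)\<^sup>2)"
  unfolding power2_norm_eq_inner by (subst euclidean_inner) (simp add: power2_eq_square)

lemma std_gauss_density_prod:
  "std_gauss_density (x :: 'a::euclidean_space) = (\<Prod>b\<in>Basis. std_normal_density (x \<bullet> b))"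
  by (simp add: std_gauss_density_def std_normal_density_def prod_dividef exp_sum[symmetric]
      norm_power2_sum_Basis sum_negf sum_divide_distrib power_divide)

lemma prob_space_std_gauss: "prob_space (std_gauss :: 'a::euclidean_space measure)"
proof
  have "emeasure std_gauss (UNIV :: 'a set) = (\<integral>\<^sup>+x. ennreal (\<Prod>b\<in>Basis. std_normal_density ((x :: 'a) \<bullet> b)) \<partial>lborel)"
    by (simp add: std_gauss_def emeasure_density std_gauss_density_prod)
  also have "\<dots> = (\<integral>\<^sup>+x. (\<Prod>b\<in>Basis. ennreal (std_normal_density ((x :: 'a) \<bullet> b))) \<partial>lborel)"
    by (simp add: prod_ennreal)
  also have "\<dots> = (\<Prod>b\<in>(Basis :: 'a set). \<integral>\<^sup>+x. ennreal (std_normal_density x) \<partial>lborel)"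
    by (intro nn_integral_lborel_prod) auto
  also have "(\<integral>\<^sup>+x. ennreal (std_normal_density x) \<partial>lborel) = 1"
    by (simp add: nn_integral_eq_integral)
  finally show "emeasure (std_gauss :: 'a measure) (space std_gauss) = 1" by simp
qed

lemma nn_integral_exp_quadratic:
  assumes "0 < n"
  shows "(\<integral>\<^sup>+t. ennreal (exp (- (n * t\<^sup>2) / 2)) \<partial>lborel) = ennreal (sqrt (2 * pi / n))"
proof -
  define s where "s = 1 / sqrt n"
  have s: "0 < s" "s\<^sup>2 = 1 / n" using assms by (auto simp: s_def power_divide)
  have "exp (- (n * t\<^sup>2) / 2) = sqrt (2 * pi / n) * normal_density 0 s t" for t
    using assms unfolding normal_density_def s(2) by (simp add: field_simps)
  then have "(\<integral>\<^sup>+t. ennreal (exp (- (n * t\<^sup>2) / 2)) \<partial>lborel) = (\<integral>\<^sup>+t. ennreal (sqrt (2 * pi / n)) * ennreal (normal_density 0 s t) \<partial>lborel)"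
    using assms by (simp add: ennreal_mult)
  also have "\<dots> = ennreal (sqrt (2 * pi / n))"
    using s by (simp add: nn_integral_cmult nn_integral_eq_integral)
  finally show ?thesis .
qed

text \<open>
  The coordinate along \<open>b1\<close> is exchanged for the mean \<open>t\<close> of all coordinates, the others are replaced by
  their deviations \<open>y\<close> from \<open>t\<close>. The deviation along \<open>b1\<close> is \<open>- (\<Sum>i\<in>I. y i)\<close>, so the squared
  norm becomes \<open>n * t\<^sup>2\<close> plus the sum of the \<open>(y i)\<^sup>2\<close> plus \<open>(\<Sum>i\<in>I. y i)\<^sup>2\<close>, and \<open>t\<close> integrates out.
  Only a one-dimensional affine substitution and a translation are needed, in place of a Jacobian determinant.
\<close>

lemma emeasure_gauss_above_mean:
  fixes b1 :: "'a::euclidean_space"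
  assumes b1: "b1 \<in> Basis"
  defines "n \<equiv> real DIM('a)" and "I \<equiv> Basis - {b1}"
  shows "emeasure std_gauss {z. \<forall>b\<in>I. (\<Sum>c\<in>Basis. z \<bullet> c) / n \<le> z \<bullet> b}
    = ennreal (n * sqrt (2 * pi / n) / sqrt (2 * pi) ^ DIM('a)) *
      (\<integral>\<^sup>+y. ennreal ((\<Prod>i\<in>I. indicator {0..} (y i) * exp (- (y i)\<^sup>2 / 2)) * exp (- (\<Sum>i\<in>I. y i)\<^sup>2 / 2)) \<partial>(\<Pi>\<^sub>M i\<in>I. lborel))"
proof -
  interpret product_sigma_finite "\<lambda>_::'a. lborel :: real measure" ..
  have I: "finite I" "b1 \<notin> I" "Basis = insert b1 I" "n = real (card I) + 1"
    using b1 by (auto simp: I_def n_def card_Suc_Diff1 simp flip: of_nat_Suc)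
  have n: "0 < n" by (simp add: n_def)
  let ?P = "\<Pi>\<^sub>M i\<in>I. (lborel :: real measure)"
  interpret P: finite_product_sigma_finite "\<lambda>_::'a. lborel :: real measure" I by standard (rule I)
  interpret PN: pair_sigma_finite ?P "lborel :: real measure" ..
  define A where "A = {z :: 'a. \<forall>b\<in>I. (\<Sum>c\<in>Basis. z \<bullet> c) / n \<le> z \<bullet> b}"
  define c where "c = 1 / sqrt (2 * pi) ^ DIM('a)"
  define k where "k y = (\<Prod>i\<in>I. indicator {0..} (y i) * exp (- (y i)\<^sup>2 / 2)) * exp (- (\<Sum>i\<in>I. y i)\<^sup>2 / 2)" for y :: "'a \<Rightarrow> real"
  have k0: "0 \<le> k y" for y by (auto simp: k_def intro!: mult_nonneg_nonneg prod_nonneg)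
  have [measurable]: "k \<in> borel_measurable ?P" unfolding k_def by measurable
  define h :: "('a \<Rightarrow> real) \<Rightarrow> real" where
    "h f = c * exp (- (\<Sum>b\<in>Basis. (f b)\<^sup>2) / 2) * (\<Prod>b\<in>I. indicator {0..} (f b - (\<Sum>c\<in>Basis. f c) / n))" for f
  have sub: "b \<in> Basis" if "b \<in> I" for b using that by (simp add: I_def)
  have [measurable]: "(\<lambda>f. \<Sum>c\<in>Basis. f c) \<in> borel_measurable (\<Pi>\<^sub>M b\<in>(Basis::'a set). (lborel :: real measure))"
    by (rule borel_measurable_sum) (auto simp: measurable_lborel1[symmetric] simp del: measurable_lborel1)
  have [measurable]: "h \<in> borel_measurable (\<Pi>\<^sub>M b\<in>Basis. lborel)"
    unfolding h_def
    by (intro borel_measurable_times borel_measurable_prod borel_measurable_const borel_measurable_exp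
        measurable_compose[OF _ borel_measurable_indicator[of "{0..}" borel]]) (use sub in measurable)
  have [measurable]: "(\<lambda>z. \<Sum>c\<in>Basis. z \<bullet> c) \<in> borel_measurable (borel :: 'a measure)"
    by (rule borel_measurable_sum) measurable
  have [measurable]: "A \<in> sets borel" unfolding A_def using I(1) by measurable
  have ind: "indicator A z = (\<Prod>b\<in>I. indicator {0..} (z \<bullet> b - (\<Sum>c\<in>Basis. z \<bullet> c) / n) :: real)" for z
    using I(1) by (cases "z \<in> A") (auto simp: A_def indicator_def)
  have "emeasure std_gauss A = (\<integral>\<^sup>+z. ennreal (std_gauss_density z * indicator A z) \<partial>lborel)"
    unfolding std_gauss_def by (subst emeasure_density) (auto intro!: nn_integral_cong simp: indicator_def)
  also have "\<dots> = (\<integral>\<^sup>+z. ennreal (h (\<lambda>b. z \<bullet> b)) \<partial>lborel)"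
    by (intro nn_integral_cong) (simp add: ind h_def std_gauss_density_def norm_power2_sum_Basis c_def)
  also have "\<dots> = (\<integral>\<^sup>+f. ennreal (h (\<lambda>b. (\<Sum>c\<in>Basis. f c *\<^sub>R c) \<bullet> b)) \<partial>(\<Pi>\<^sub>M b\<in>(Basis::'a set). lborel))"
  proof -
    have [measurable]: "(\<lambda>z. ennreal (h (\<lambda>b. z \<bullet> b))) \<in> borel_measurable borel"
      unfolding h_def by measurable
    show ?thesis
      by (subst lborel_eq[where 'a='a], subst nn_integral_distr) auto
  qed
  also have "\<dots> = (\<integral>\<^sup>+f. ennreal (h f) \<partial>(\<Pi>\<^sub>M b\<in>(Basis::'a set). lborel))"
  proof (intro nn_integral_cong)
    fix f :: "'a \<Rightarrow> real"
    have comp: "(\<Sum>c\<in>Basis. f c *\<^sub>R c) \<bullet> b = f b" if "b \<in> Basis" for b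
      using that by simp
    have "h (\<lambda>b. (\<Sum>c\<in>Basis. f c *\<^sub>R c) \<bullet> b) = h f"
      unfolding h_def by (intro arg_cong2[of _ _ _ _ "(*)"] arg_cong[of _ _ exp] arg_cong[of _ _ uminus]
        arg_cong2[of _ _ _ _ "(/)"] prod.cong sum.cong arg_cong[of _ _ "indicator {0..}"] arg_cong2[of _ _ _ _ "(-)"] refl)
        (simp_all add: comp sub)
    then show "ennreal (h (\<lambda>b. (\<Sum>c\<in>Basis. f c *\<^sub>R c) \<bullet> b)) = ennreal (h f)" by simp
  qed
  also have "\<dots> = (\<integral>\<^sup>+f. (\<integral>\<^sup>+y. ennreal (h (f(b1 := y))) \<partial>lborel) \<partial>?P)"
    unfolding I(3) by (rule product_nn_integral_insert[OF I(1,2)]) (simp add: I(3)[symmetric])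
  \<comment> \<open>Substitution of \<open>- (\<Sum>b\<in>I. f b) + n * t\<close> for the coordinate along \<open>b1\<close>, which makes \<open>t\<close> the mean.\<close>
  also have "\<dots> = (\<integral>\<^sup>+f. ennreal n * (\<integral>\<^sup>+t. ennreal (h (f(b1 := - (\<Sum>b\<in>I. f b) + n * t))) \<partial>lborel) \<partial>?P)"
  proof (rule nn_integral_cong)
    fix f assume f: "f \<in> space ?P"
    have "(\<lambda>y. f(b1 := y)) \<in> borel \<rightarrow>\<^sub>M (\<Pi>\<^sub>M b\<in>Basis. lborel)"
      by (rule measurable_fun_upd[where J=I]) (use I(3) f in auto)
    then have [measurable]: "(\<lambda>y. ennreal (h (f(b1 := y)))) \<in> borel_measurable borel"
      by measurable
    show "(\<integral>\<^sup>+y. ennreal (h (f(b1 := y))) \<partial>lborel) = ennreal n * (\<integral>\<^sup>+t. ennreal (h (f(b1 := - (\<Sum>b\<in>I. f b) + n * t))) \<partial>lborel)"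
      using n by (subst nn_integral_real_affine[where t="- (\<Sum>b\<in>I. f b)" and c=n]) auto
  qed
  also have "\<dots> = (\<integral>\<^sup>+f. \<integral>\<^sup>+t. ennreal n * ennreal (c * exp (- ((\<Sum>b\<in>I. (f b)\<^sup>2) + (n * t - (\<Sum>b\<in>I. f b))\<^sup>2) / 2) * (\<Prod>b\<in>I. indicator {0..} (f b - t))) \<partial>lborel \<partial>?P)"
  proof (intro nn_integral_cong)
    fix f :: "'a \<Rightarrow> real"
    have h: "h (f(b1 := - (\<Sum>b\<in>I. f b) + n * t)) = c * exp (- ((\<Sum>b\<in>I. (f b)\<^sup>2) + (n * t - (\<Sum>b\<in>I. f b))\<^sup>2) / 2) * (\<Prod>b\<in>I. indicator {0..} (f b - t))" for t
    proof -
      let ?f = "f(b1 := - (\<Sum>b\<in>I. f b) + n * t)"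
      have eq: "(\<Sum>b\<in>I. g (?f b)) = (\<Sum>b\<in>I. g (f b))" for g :: "real \<Rightarrow> real"
        using I(2) by (intro sum.cong) auto
      have "(\<Sum>c\<in>Basis. ?f c) = n * t"
        using eq[of "\<lambda>x. x"] I(1,2) unfolding I(3) by simp
      moreover have "(\<Sum>c\<in>Basis. (?f c)\<^sup>2) = (\<Sum>b\<in>I. (f b)\<^sup>2) + (n * t - (\<Sum>b\<in>I. f b))\<^sup>2"
        using eq[of "\<lambda>x. x\<^sup>2"] I(1,2) unfolding I(3) by simp
      moreover have "(\<Prod>b\<in>I. indicator {0..} (?f b - t)) = (\<Prod>b\<in>I. indicator {0..} (f b - t) :: real)"
        using I(2) by (intro prod.cong) auto
      ultimately show ?thesis using n unfolding h_def by simp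
    qed
    show "ennreal n * (\<integral>\<^sup>+t. ennreal (h (f(b1 := - (\<Sum>b\<in>I. f b) + n * t))) \<partial>lborel)
      = (\<integral>\<^sup>+t. ennreal n * ennreal (c * exp (- ((\<Sum>b\<in>I. (f b)\<^sup>2) + (n * t - (\<Sum>b\<in>I. f b))\<^sup>2) / 2) * (\<Prod>b\<in>I. indicator {0..} (f b - t))) \<partial>lborel)"
      unfolding h by (rule nn_integral_cmult[symmetric]) measurable
  qed
  also have "\<dots> = (\<integral>\<^sup>+t. \<integral>\<^sup>+f. ennreal n * ennreal (c * exp (- ((\<Sum>b\<in>I. (f b)\<^sup>2) + (n * t - (\<Sum>b\<in>I. f b))\<^sup>2) / 2) * (\<Prod>b\<in>I. indicator {0..} (f b - t))) \<partial>?P \<partial>lborel)"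
    by (rule PN.Fubini'[symmetric]) measurable
  also have "\<dots> = (\<integral>\<^sup>+t. ennreal (n * c) * ennreal (exp (- (n * t\<^sup>2) / 2)) * (\<integral>\<^sup>+y. ennreal (k y) \<partial>?P) \<partial>lborel)"
  proof (rule nn_integral_cong)
    fix t :: real
    let ?s = "\<lambda>x. \<lambda>b\<in>I. t + x b"
    let ?H = "\<lambda>f. ennreal n * ennreal (c * exp (- ((\<Sum>b\<in>I. (f b)\<^sup>2) + (n * t - (\<Sum>b\<in>I. f b))\<^sup>2) / 2) * (\<Prod>b\<in>I. indicator {0..} (f b - t)))"
    have "(\<integral>\<^sup>+f. ?H f \<partial>?P) = (\<integral>\<^sup>+f. ?H f \<partial>distr ?P ?P ?s)"
      using distr_PiM_lborel_translation[OF I(1), of "\<lambda>_. t"] by simp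
    also have "\<dots> = (\<integral>\<^sup>+y. ?H (?s y) \<partial>?P)"
      by (rule nn_integral_distr) measurable
    also have "\<dots> = (\<integral>\<^sup>+y. ennreal (n * c) * ennreal (exp (- (n * t\<^sup>2) / 2)) * ennreal (k y) \<partial>?P)"
    proof (rule nn_integral_cong)
      fix y :: "'a \<Rightarrow> real"
      let ?S = "\<Sum>b\<in>I. y b" and ?Q = "\<Sum>b\<in>I. (y b)\<^sup>2"
      have 1: "(\<Sum>b\<in>I. ?s y b) = real (card I) * t + ?S"
        by (simp add: sum.distrib)
      have 2: "(\<Sum>b\<in>I. (?s y b)\<^sup>2) = real (card I) * t\<^sup>2 + 2 * t * ?S + ?Q"
        by (simp add: power2_sum sum.distrib sum_distrib_left)
      have 3: "(\<Prod>b\<in>I. indicator {0..} (?s y b - t)) = (\<Prod>b\<in>I. indicator {0..} (y b) :: real)"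
        by (intro prod.cong) auto
      have 4: "(\<Sum>b\<in>I. (?s y b)\<^sup>2) + (n * t - (\<Sum>b\<in>I. ?s y b))\<^sup>2 = n * t\<^sup>2 + ?Q + ?S\<^sup>2"
        unfolding 1 2 I(4) by (simp add: power2_eq_square algebra_simps)
      have 5: "exp (- ?Q / 2) = (\<Prod>b\<in>I. exp (- (y b)\<^sup>2 / 2))"
        using I(1) by (simp add: exp_sum[symmetric] sum_negf sum_divide_distrib)
      have "c * exp (- (n * t\<^sup>2 + ?Q + ?S\<^sup>2) / 2) = c * exp (- (n * t\<^sup>2) / 2) * exp (- ?Q / 2) * exp (- ?S\<^sup>2 / 2)"
        by (simp add: exp_add[symmetric] add_divide_distrib diff_divide_distrib)
      then have "c * exp (- ((\<Sum>b\<in>I. (?s y b)\<^sup>2) + (n * t - (\<Sum>b\<in>I. ?s y b))\<^sup>2) / 2) * (\<Prod>b\<in>I. indicator {0..} (?s y b - t))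
         = c * exp (- (n * t\<^sup>2) / 2) * k y"
        unfolding 3 4 5 k_def prod.distrib by (auto simp: mult_ac)
      then show "?H (?s y) = ennreal (n * c) * ennreal (exp (- (n * t\<^sup>2) / 2)) * ennreal (k y)"
        using n by (simp add: ennreal_mult[symmetric] c_def k0 mult.assoc)
    qed
    also have "\<dots> = ennreal (n * c) * ennreal (exp (- (n * t\<^sup>2) / 2)) * (\<integral>\<^sup>+y. ennreal (k y) \<partial>?P)"
      by (rule nn_integral_cmult) measurable
    finally show "(\<integral>\<^sup>+f. ?H f \<partial>?P) = \<dots>" .
  qed
  also have "\<dots> = ennreal (n * c) * (\<integral>\<^sup>+t. ennreal (exp (- (n * t\<^sup>2) / 2)) \<partial>lborel) * (\<integral>\<^sup>+y. ennreal (k y) \<partial>?P)"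
    by (simp add: nn_integral_multc nn_integral_cmult)
  also have "\<dots> = ennreal (n * sqrt (2 * pi / n) / sqrt (2 * pi) ^ DIM('a)) * (\<integral>\<^sup>+y. ennreal (k y) \<partial>?P)"
    using n unfolding nn_integral_exp_quadratic[OF n] by (simp add: ennreal_mult[symmetric] c_def)
  finally show ?thesis unfolding A_def k_def .
qed

text \<open>
  The constants of \<open>emeasure_gauss_above_mean\<close> and \<open>orthant_gaussian_integral\<close> combine with the scaling of \<open>x\<close> by \<open>1 / sqrt n\<close>, which
  normalises the factor \<open>exp (- n * x\<^sup>2 / 2)\<close> collected from the \<open>n - 1\<close> Fourier transforms and the normal density.
\<close>

theorem measure_gauss_above_mean:
  fixes b1 :: "'a::euclidean_space"
  assumes b1: "b1 \<in> Basis"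
  shows "complex_of_real (measure std_gauss {z. \<forall>b\<in>Basis - {b1}. (\<Sum>c\<in>Basis. z \<bullet> c) / real DIM('a) \<le> z \<bullet> b})
    = complex_of_real (1 / sqrt (2 * pi)) *
      (\<integral>x. Phi (\<i> * complex_of_real (x / sqrt (real DIM('a)))) ^ (DIM('a) - 1) * complex_of_real (exp (- x\<^sup>2 / 2)) \<partial>lborel)"
proof -
  define I where "I = Basis - {b1}"
  define n where "n = real DIM('a)"
  define m where "m = DIM('a) - 1"
  have I: "finite I" "card I = m" using b1 by (simp_all add: I_def m_def)
  have n: "0 < n" and nm: "n = real m + 1" and dim: "DIM('a) = Suc m"
    using DIM_positive[where 'a='a] by (auto simp: n_def m_def)
  define k where "k y = (\<Prod>i\<in>I. indicator {0..} (y i) * exp (- (y i)\<^sup>2 / 2)) * exp (- (\<Sum>i\<in>I. y i)\<^sup>2 / 2)" for y :: "'a \<Rightarrow> real"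
  have k0: "0 \<le> k y" for y by (auto simp: k_def intro!: mult_nonneg_nonneg prod_nonneg)
  let ?J = "\<integral>y. k y \<partial>(\<Pi>\<^sub>M i\<in>I. lborel)"
  have "emeasure std_gauss {z. \<forall>b\<in>I. (\<Sum>c\<in>Basis. z \<bullet> c) / n \<le> z \<bullet> b}
    = ennreal (n * sqrt (2 * pi / n) / sqrt (2 * pi) ^ DIM('a)) * (\<integral>\<^sup>+y. ennreal (k y) \<partial>(\<Pi>\<^sub>M i\<in>I. lborel))"
    using emeasure_gauss_above_mean[OF b1] unfolding I_def n_def k_def .
  also have "(\<integral>\<^sup>+y. ennreal (k y) \<partial>(\<Pi>\<^sub>M i\<in>I. lborel)) = ennreal ?J"
    using orthant_gaussian_integral(1)[OF I(1)] k0 unfolding k_def by (intro nn_integral_eq_integral) auto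
  finally have meas: "measure std_gauss {z. \<forall>b\<in>I. (\<Sum>c\<in>Basis. z \<bullet> c) / n \<le> z \<bullet> b} = n * sqrt (2 * pi / n) / sqrt (2 * pi) ^ DIM('a) * ?J"
    using n k0 by (simp add: measure_def enn2real_mult ennreal_mult[symmetric] Bochner_Integration.integral_nonneg del: ennreal_mult)
  let ?r = "sqrt (2 * pi)"
  let ?e = "\<lambda>x. complex_of_real (exp (- x\<^sup>2 / 2))"
  have "complex_of_real ?J = (\<integral>x. (complex_of_real (?r * exp (- x\<^sup>2 / 2)) * Phi (\<i> * complex_of_real x)) ^ m \<partial>std_normal_distribution)"
    using orthant_gaussian_integral(2)[OF I(1)] unfolding k_def I(2) .
  also have "\<dots> = (\<integral>x. std_normal_density x *\<^sub>R (complex_of_real (?r * exp (- x\<^sup>2 / 2)) * Phi (\<i> * complex_of_real x)) ^ m \<partial>lborel)"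
  proof (rule integral_density)
    have [measurable]: "(\<lambda>x. Phi (\<i> * complex_of_real x)) \<in> borel_measurable borel"
      by (intro borel_measurable_continuous_onI continuous_on_compose2[OF continuous_on_Phi] continuous_intros) auto
    show "(\<lambda>x. (complex_of_real (?r * exp (- x\<^sup>2 / 2)) * Phi (\<i> * complex_of_real x)) ^ m) \<in> borel_measurable lborel"
      by measurable
  qed auto
  also have "\<dots> = (\<integral>x. complex_of_real (?r ^ m / ?r) * (Phi (\<i> * complex_of_real x) ^ m * complex_of_real (exp (- (n * x\<^sup>2) / 2))) \<partial>lborel)"
  proof (intro Bochner_Integration.integral_cong refl)
    fix x
    have "exp (- x\<^sup>2 / 2) ^ m * exp (- x\<^sup>2 / 2) = exp (- (n * x\<^sup>2) / 2)"
      unfolding exp_of_nat_mult[symmetric] exp_add[symmetric] by (simp add: nm field_simps)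
    then show "std_normal_density x *\<^sub>R (complex_of_real (?r * exp (- x\<^sup>2 / 2)) * Phi (\<i> * complex_of_real x)) ^ m
      = complex_of_real (?r ^ m / ?r) * (Phi (\<i> * complex_of_real x) ^ m * complex_of_real (exp (- (n * x\<^sup>2) / 2)))"
      unfolding scaleR_conv_of_real std_normal_density_def power_mult_distrib
      by (simp add: mult_ac power_mult_distrib flip: of_real_mult of_real_power)
  qed
  also have "\<dots> = complex_of_real (?r ^ m / ?r) * (\<integral>x. Phi (\<i> * complex_of_real x) ^ m * complex_of_real (exp (- (n * x\<^sup>2) / 2)) \<partial>lborel)"
    by simp
  also have "(\<integral>x. Phi (\<i> * complex_of_real x) ^ m * complex_of_real (exp (- (n * x\<^sup>2) / 2)) \<partial>lborel)
    = (1 / sqrt n) *\<^sub>R (\<integral>x. Phi (\<i> * complex_of_real (x / sqrt n)) ^ m * ?e x \<partial>lborel)"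
    using n by (subst lborel_integral_real_affine[where c="1 / sqrt n" and t=0]) (auto simp: power_divide)
  finally have J: "complex_of_real ?J = complex_of_real (?r ^ m / ?r) * ((1 / sqrt n) *\<^sub>R (\<integral>x. Phi (\<i> * complex_of_real (x / sqrt n)) ^ m * ?e x \<partial>lborel))" .
  have const: "n * sqrt (2 * pi / n) / ?r ^ DIM('a) * (?r ^ m / ?r) * (1 / sqrt n) = 1 / ?r"
    using n by (simp add: dim real_sqrt_divide field_simps)
  show ?thesis
    unfolding I_def[symmetric] n_def[symmetric] m_def[symmetric] meas of_real_mult[of _ ?J] J
    unfolding const[symmetric] by (simp add: scaleR_conv_of_real mult_ac)
qed

section \<open>Isometry invariance of Gaussian vectors\<close>

lemma distr_std_gauss_isometry:
  fixes T :: "'a::euclidean_space \<Rightarrow> 'a"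
  assumes T: "orthogonal_transformation T"
  shows "distr std_gauss borel T = std_gauss"
proof -
  have lin: "linear T" and nrm: "\<And>x. norm (T x) = norm x"
    using T by (auto simp: orthogonal_transformation)
  have [measurable]: "T \<in> borel_measurable borel"
    using lin by (intro borel_measurable_continuous_onI linear_continuous_on) (simp add: linear_conv_bounded_linear)
  have "std_gauss = density (distr lborel borel T) (\<lambda>x. ennreal (std_gauss_density x))"
    by (simp add: std_gauss_def distr_lborel_isometry[OF T])
  also have "\<dots> = distr (density lborel (\<lambda>x. ennreal (std_gauss_density (T x)))) borel T"
    by (rule density_distr) measurable
  also have "\<dots> = distr std_gauss borel T"
    by (simp add: std_gauss_def std_gauss_density_def nrm)
  finally show ?thesis ..
qed

lemma AE_std_gauss:
  assumes "AE x in lborel. P x"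
  shows "AE x in std_gauss. P x"
  unfolding std_gauss_def using assms by (subst AE_density) auto

lemma AE_std_gauss_not_orthogonal:
  fixes a :: "'a::euclidean_space"
  assumes "a \<noteq> 0"
  shows "AE z in std_gauss. z \<bullet> a \<noteq> 0"
proof (rule AE_std_gauss)
  have "{x. a \<bullet> x = 0} \<in> null_sets lebesgue"
    using negligible_hyperplane[of a 0] assms by (simp add: negligible_iff_null_sets)
  moreover have "{x. a \<bullet> x = 0} \<in> sets lborel"
    using closed_hyperplane[of a 0] by simp
  ultimately have "{x. a \<bullet> x = 0} \<in> null_sets lborel" by (simp add: null_sets_completion_iff)
  from AE_not_in[OF this] show "AE z in lborel. z \<bullet> a \<noteq> 0"
    by eventually_elim (simp add: inner_commute)
qed

section \<open>Null sets of polynomials\<close>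

text \<open>
  On each line through \<open>v\<close> the function is a polynomial that does not vanish at \<open>v\<close>, so it has finitely
  many zeros there. By Fubini, for almost every \<open>t\<close> the zeros are avoided by almost all points
  \<open>(1 - t) *\<^sub>R x + t *\<^sub>R v\<close>. One such \<open>t\<close> is enough, since \<open>x \<mapsto> (1 - t) *\<^sub>R x + t *\<^sub>R v\<close> preserves null sets.
\<close>

lemma AE_nonzero_if_polynomial_on_lines:
  fixes f :: "'a::euclidean_space \<Rightarrow> real"
  assumes [measurable]: "f \<in> borel_measurable borel"
    and poly: "\<And>x. \<exists>p. \<forall>t. f ((1 - t) *\<^sub>R x + t *\<^sub>R v) = poly p t"
    and v: "f v \<noteq> 0"
  shows "AE x in lborel. f x \<noteq> 0"
proof -
  have "AE x in lborel. AE t in lborel. f ((1 - t) *\<^sub>R x + t *\<^sub>R v) \<noteq> 0"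
  proof (rule AE_I2)
    fix x
    obtain p where p: "\<And>t. f ((1 - t) *\<^sub>R x + t *\<^sub>R v) = poly p t" using poly by blast
    with v have "poly p 1 \<noteq> 0" by (metis add_0 diff_self scaleR_one scaleR_zero_left)
    then have "finite {t. poly p t = 0}" by (metis poly_0 poly_roots_finite)
    then have "{t. poly p t = 0} \<in> null_sets lborel" by (intro finite_imp_null_set_lborel)
    then show "AE t in lborel. f ((1 - t) *\<^sub>R x + t *\<^sub>R v) \<noteq> 0"
      unfolding p by (auto dest: AE_not_in)
  qed
  then have "AE t in lborel. AE x in lborel. f ((1 - t) *\<^sub>R x + t *\<^sub>R v) \<noteq> 0"
    by (subst (asm) lborel_pair.AE_commute) measurable
  moreover have "AE t in lborel. t \<noteq> (1::real)" by (rule AE_lborel_singleton)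
  ultimately have "AE t in lborel. t \<noteq> 1 \<and> (AE x in lborel. f ((1 - t) *\<^sub>R x + t *\<^sub>R v) \<noteq> 0)"
    by simp
  moreover have "ae_filter (lborel :: real measure) \<noteq> bot"
    by (simp add: ae_filter_eq_bot_iff)
  ultimately obtain t where t: "t \<noteq> 1" and nz: "AE x in lborel. f ((1 - t) *\<^sub>R x + t *\<^sub>R v) \<noteq> 0"
    using eventually_happens'[of "ae_filter (lborel :: real measure)"] by blast
  have "1 - t \<noteq> 0" using t by simp
  from lborel_affine[OF this, of "t *\<^sub>R v"] have eq:
    "(lborel :: 'a measure) = density (distr lborel borel (\<lambda>x. t *\<^sub>R v + (1 - t) *\<^sub>R x)) (\<lambda>_. \<bar>1 - t\<bar> ^ DIM('a))" .
  show ?thesis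
    using nz by (subst eq) (simp add: AE_density AE_distr_iff add.commute)
qed

lemma det_polynomial:
  fixes A :: "real \<Rightarrow> real^'n^'n"
  assumes "\<And>i j. \<exists>p. \<forall>t. A t $ i $ j = poly p t"
  shows "\<exists>p. \<forall>t. det (A t) = poly p t"
proof -
  obtain P where P: "\<And>i j t. A t $ i $ j = poly (P i j) t" using assms by metis
  have "det (A t) = poly (\<Sum>\<sigma> | \<sigma> permutes UNIV. smult (of_int (sign \<sigma>)) (\<Prod>i\<in>UNIV. P i (\<sigma> i))) t" for t
    by (simp add: det_def P poly_sum poly_prod)
  then show ?thesis by blast
qed

section \<open>The affine relation between d + 2 points\<close>

text \<open>
  A sample of \<open>CARD('n)\<close> points in \<open>real^'d\<close> is a matrix \<open>R\<close> of type \<open>real^'n^'d\<close>: \<open>R $ k\<close> collects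
  the \<open>k\<close>-th coordinates of all points. Together with the all-ones row and one free row it fills a square
  matrix. The locale fixes the places of these rows: \<open>r0\<close> is the free one, \<open>r1\<close> the
  all-ones one, and \<open>f k\<close> holds \<open>R $ k\<close>. In particular there are \<open>CARD('d) + 2\<close> points.
\<close>

locale gale =
  fixes r0 r1 :: "'n::finite" and f :: "'d::finite \<Rightarrow> 'n"
  assumes r01: "r0 \<noteq> r1" and inj_f: "inj f" and range_f: "range f = UNIV - {r0, r1}"
begin

definition bordered_matrix :: "real^'n \<Rightarrow> real^'n^'d \<Rightarrow> real^'n^'n" where
  "bordered_matrix z R = (\<chi> i. if i = r0 then z else if i = r1 then 1 else R $ inv f i)"

text \<open>
  The generalised cross product of the all-ones vector and the rows of \<open>R\<close>: its entries are the cofactors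
  along the free row.
\<close>

definition gale_vector :: "real^'n^'d \<Rightarrow> real^'n" where
  "gale_vector R = (\<chi> i. det (bordered_matrix (axis i 1) R))"

lemma f_neq [simp]: "f k \<noteq> r0" "f k \<noteq> r1" "inv f (f k) = k"
  using range_f inj_f by (auto simp: inv_f_f)

lemma row_cases: obtains "i = r0" | "i = r1" | k where "i = f k"
  using range_f by blast

lemma bordered_matrix_row [simp]: "bordered_matrix z R $ r0 = z" "bordered_matrix z R $ r1 = 1" "bordered_matrix z R $ f k = R $ k"
  using r01 by (auto simp: bordered_matrix_def)

lemma bordered_matrix_if: "bordered_matrix z R = (\<chi> i. if i = r0 then z else bordered_matrix 0 R $ i)"
  by (auto simp: bordered_matrix_def vec_eq_iff)

lemma card_n: "CARD('n) = CARD('d) + 2"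
proof -
  have "CARD('d) = card (UNIV - {r0, r1})"
    using range_f card_image[OF inj_f] by simp
  also have "\<dots> = CARD('n) - 2" using r01 by (simp add: card_Diff_subset)
  finally have "CARD('d) = CARD('n) - 2" .
  moreover have "card {r0, r1} \<le> CARD('n)" by (intro card_mono) auto
  ultimately show ?thesis using r01 by simp
qed

text \<open>
  Expansion of the determinant along the free row. Orthogonality to the other rows, equivariance under isometries
  and the kernel description below all follow from this formula.
\<close>

lemma inner_gale_vector: "gale_vector R \<bullet> z = det (bordered_matrix z R)"
proof -
  have lin: "linear (\<lambda>z. det (bordered_matrix z R))"
  proof (rule linearI)
    fix x y :: "real^'n" and c :: real
    show "det (bordered_matrix (x + y) R) = det (bordered_matrix x R) + det (bordered_matrix y R)"
      using det_row_add[of r0 "\<lambda>_. x" "\<lambda>_. y" "\<lambda>i. bordered_matrix 0 R $ i"]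
      by (simp add: bordered_matrix_if[symmetric])
    show "det (bordered_matrix (c *\<^sub>R x) R) = c *\<^sub>R det (bordered_matrix x R)"
      using det_row_mul[of r0 c "\<lambda>_. x" "\<lambda>i. bordered_matrix 0 R $ i"]
      by (simp add: bordered_matrix_if[symmetric] scalar_mult_eq_scaleR)
  qed
  have "det (bordered_matrix z R) = det (bordered_matrix (\<Sum>i\<in>UNIV. z $ i *\<^sub>R axis i 1) R)"
    using basis_expansion[of z] by (simp add: scalar_mult_eq_scaleR)
  also have "\<dots> = (\<Sum>i\<in>UNIV. z $ i * det (bordered_matrix (axis i 1) R))"
    using linear_sum[OF lin, of "\<lambda>i. z $ i *\<^sub>R axis i 1" UNIV] by (simp add: linear_cmul[OF lin])
  finally show ?thesis by (simp add: inner_vec_def gale_vector_def mult.commute)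
qed

lemma inner_gale_vector_one [simp]: "gale_vector R \<bullet> 1 = 0"
  unfolding inner_gale_vector by (rule det_identical_rows[OF r01]) (simp add: row_def)

lemma inner_gale_vector_row [simp]: "gale_vector R \<bullet> (R $ k) = 0"
  unfolding inner_gale_vector by (rule det_identical_rows[of r0 "f k"]) (auto simp: row_def f_neq[symmetric] simp del: f_neq)

text \<open>
  An isometry that fixes the all-ones vector multiplies every row of the bordered matrix, the free one included,
  by an orthogonal matrix; the sign \<open>s\<close> is its determinant.
\<close>

lemma gale_vector_orthogonal:
  assumes T: "orthogonal_transformation T" and T1: "T 1 = 1"
  shows "\<exists>s\<in>{1, -1}. \<forall>R. gale_vector (\<chi> k. T (R $ k)) = s *\<^sub>R T (gale_vector R)"
proof -
  have lin: "linear T" and inner: "\<And>x y. T x \<bullet> T y = x \<bullet> y"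
    using T by (auto simp: orthogonal_transformation_def)
  define Q where "Q = matrix T"
  have TQ: "T x = Q *v x" for x using lin by (simp add: Q_def matrix_works)
  have "orthogonal_matrix Q" using T by (simp add: Q_def orthogonal_transformation_matrix)
  then have detQ: "det Q = 1 \<or> det Q = -1" by (rule det_orthogonal_matrix)
  have "bordered_matrix (T z) (\<chi> k. T (R $ k)) = bordered_matrix z R ** transpose Q" for z R
  proof -
    have "(bordered_matrix z R ** transpose Q) $ i = T (bordered_matrix z R $ i)" for i
      by (simp add: TQ vec_eq_iff matrix_matrix_mult_def matrix_vector_mult_def transpose_def mult.commute)
    then have "bordered_matrix (T z) (\<chi> k. T (R $ k)) $ i = (bordered_matrix z R ** transpose Q) $ i" for i
      by (cases i rule: row_cases) (simp_all add: T1)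
    then show ?thesis by (simp add: vec_eq_iff)
  qed
  then have "gale_vector (\<chi> k. T (R $ k)) \<bullet> T z = det Q * (gale_vector R \<bullet> z)" for z R
    by (simp add: inner_gale_vector det_mul)
  then have "gale_vector (\<chi> k. T (R $ k)) \<bullet> T z = (det Q *\<^sub>R T (gale_vector R)) \<bullet> T z" for z R
    by (simp add: inner)
  then have "gale_vector (\<chi> k. T (R $ k)) \<bullet> T (inv T y) = (det Q *\<^sub>R T (gale_vector R)) \<bullet> T (inv T y)" for y R .
  then have "gale_vector (\<chi> k. T (R $ k)) \<bullet> y = (det Q *\<^sub>R T (gale_vector R)) \<bullet> y" for y R
    unfolding surj_f_inv_f[OF bij_is_surj[OF orthogonal_transformation_bij[OF T]]] .
  then have "gale_vector (\<chi> k. T (R $ k)) = det Q *\<^sub>R T (gale_vector R)" for R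
    by (metis vector_eq_rdot)
  then show ?thesis using detQ by auto
qed

lemma gale_vector_flip: "gale_vector (\<chi> k. if k = k0 then - (R $ k) else R $ k) = - gale_vector R"
proof -
  let ?R' = "\<chi> k. if k = k0 then - (R $ k) else R $ k"
  have eq: "bordered_matrix z R = (\<chi> i. if i = f k0 then R $ k0 else bordered_matrix z R $ i)" for z
    by (simp add: vec_eq_iff)
  have "bordered_matrix z ?R' $ i = (if i = f k0 then (-1) *s (R $ k0) else bordered_matrix z R $ i)" for z i
    by (cases i rule: row_cases) (auto simp: scalar_mult_eq_scaleR f_neq[symmetric] inj_eq[OF inj_f] simp del: f_neq(1,2))
  then have "bordered_matrix z ?R' = (\<chi> i. if i = f k0 then (-1) *s (R $ k0) else bordered_matrix z R $ i)" for z
    by (simp add: vec_eq_iff)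
  then have "det (bordered_matrix z ?R') = - det (bordered_matrix z R)" for z
    using det_row_mul[of "f k0" "-1" "\<lambda>_. R $ k0" "\<lambda>i. bordered_matrix z R $ i"] by (simp add: eq[symmetric])
  then show ?thesis by (simp add: gale_vector_def vec_eq_iff)
qed

text \<open>
  If the \<open>i\<close>-th minor is nonzero then the bordered matrix with free row \<open>axis i 1\<close> is invertible, so a vector
  orthogonal to the remaining rows is determined by its \<open>i\<close>-th entry.
\<close>

lemma gale_vector_spans_kernel:
  assumes l: "gale_vector R $ i \<noteq> 0" and m: "\<mu> \<bullet> 1 = 0" "\<And>k. \<mu> \<bullet> (R $ k) = 0"
  shows "\<mu> = (\<mu> $ i / gale_vector R $ i) *\<^sub>R gale_vector R"
proof -
  define A where "A = bordered_matrix (axis i 1) R"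
  have "invertible A"
    using l by (simp add: A_def gale_vector_def invertible_det_nz)
  have comp: "(A *v y) $ j = (A $ j) \<bullet> y" for y j by (simp add: matrix_vector_mul_component)
  have "(A *v (gale_vector R $ i *\<^sub>R \<mu> - \<mu> $ i *\<^sub>R gale_vector R)) $ j = 0" for j
    unfolding comp by (cases j rule: row_cases)
       (simp_all add: A_def inner_diff_right inner_commute[of _ \<mu>] inner_commute[of _ "gale_vector R"] m inner_axis)
  then have "A *v (gale_vector R $ i *\<^sub>R \<mu> - \<mu> $ i *\<^sub>R gale_vector R) = 0" by (simp add: vec_eq_iff)
  then have "gale_vector R $ i *\<^sub>R \<mu> - \<mu> $ i *\<^sub>R gale_vector R = 0"
    using \<open>invertible A\<close> by (metis invertible_def matrix_left_invertible_ker)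
  then have "(1 / gale_vector R $ i) *\<^sub>R (gale_vector R $ i *\<^sub>R \<mu>) = (1 / gale_vector R $ i) *\<^sub>R (\<mu> $ i *\<^sub>R gale_vector R)" by simp
  then show ?thesis using l by simp
qed

lemma kernel_if_gale_vector_eq_0:
  assumes "gale_vector R $ i = 0"
  obtains \<mu> where "\<mu> \<noteq> 0" "\<mu> $ i = 0" "\<mu> \<bullet> 1 = 0" "\<And>k. \<mu> \<bullet> (R $ k) = 0"
proof -
  define A where "A = bordered_matrix (axis i 1) R"
  have "\<not> invertible A" using assms by (simp add: A_def gale_vector_def invertible_det_nz)
  then obtain \<mu> where m: "\<mu> \<noteq> 0" "A *v \<mu> = 0"
    by (metis invertible_left_inverse matrix_left_invertible_ker)
  have comp: "(A $ j) \<bullet> \<mu> = 0" for j using m(2) by (metis matrix_vector_mul_component zero_index)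
  show thesis
  proof (rule that[of \<mu>])
    show "\<mu> \<noteq> 0" by fact
    show "\<mu> $ i = 0" using comp[of r0] by (simp add: A_def inner_axis')
    show "\<mu> \<bullet> 1 = 0" using comp[of r1] by (simp add: A_def inner_commute)
    show "\<mu> \<bullet> (R $ k) = 0" for k using comp[of "f k"] by (simp add: A_def inner_commute)
  qed
qed

lemma continuous_gale_vector: "continuous_on UNIV gale_vector"
proof -
  have "continuous_on UNIV (\<lambda>R. bordered_matrix z R $ i $ j)" for z i j
    by (cases i rule: row_cases) (auto intro!: continuous_intros)
  then show ?thesis
    unfolding gale_vector_def det_def
    by (intro continuous_on_vec_lambda continuous_on_sum continuous_on_mult continuous_on_const continuous_on_prod)
qed

lemma measurable_gale_vector [measurable]: "gale_vector \<in> borel_measurable borel"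
  by (rule borel_measurable_continuous_onI[OF continuous_gale_vector])

text \<open>
  The minor at \<open>r0\<close> is a polynomial in \<open>R\<close> that does not vanish at the sample \<open>V\<close> with rows
  \<open>axis (f k) 1\<close>: a kernel vector for \<open>V\<close> vanishes at all \<open>f k\<close> and at \<open>r0\<close>, and so at \<open>r1\<close> too
  because its entries sum to 0.
\<close>

lemma AE_gale_vector_nonzero: "AE R in lborel. gale_vector R \<noteq> 0"
proof -
  define V :: "real^'n^'d" where "V = (\<chi> k. axis (f k) 1)"
  have [measurable]: "(\<lambda>R. gale_vector R $ r0) \<in> borel_measurable borel"
    by (intro borel_measurable_continuous_onI continuous_on_component continuous_gale_vector)
  have "AE R in lborel. gale_vector R $ r0 \<noteq> 0"
  proof (rule AE_nonzero_if_polynomial_on_lines[where v=V])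
    show "\<exists>p. \<forall>t. gale_vector ((1 - t) *\<^sub>R R + t *\<^sub>R V) $ r0 = poly p t" for R
      unfolding gale_vector_def vec_lambda_beta
    proof (rule det_polynomial)
      fix i j
      show "\<exists>p. \<forall>t. bordered_matrix (axis r0 1) ((1 - t) *\<^sub>R R + t *\<^sub>R V) $ i $ j = poly p t"
      proof (cases i rule: row_cases)
        case 1
        then show ?thesis by (intro exI[of _ "[:axis r0 1 $ j:]"]) simp
      next
        case 2
        then show ?thesis by (intro exI[of _ "[:1:]"]) simp
      next
        case (3 k)
        show ?thesis
          by (rule exI[of _ "[:R $ k $ j, V $ k $ j - R $ k $ j:]"]) (simp add: 3 algebra_simps)
      qed
    qed
    show "gale_vector V $ r0 \<noteq> 0"
    proof
      assume "gale_vector V $ r0 = 0"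
      then obtain \<mu> where m: "\<mu> \<noteq> 0" "\<mu> $ r0 = 0" "\<mu> \<bullet> 1 = 0" "\<And>k. \<mu> \<bullet> (V $ k) = 0"
        by (rule kernel_if_gale_vector_eq_0) blast
      have "\<mu> $ f k = 0" for k using m(4)[of k] by (simp add: V_def inner_axis)
      then have other: "\<mu> $ i = 0" if "i \<noteq> r1" for i
        using m(2) that by (cases i rule: row_cases) auto
      have "0 = (\<Sum>i\<in>UNIV. \<mu> $ i)" using m(3) by (simp add: inner_vec_def)
      also have "\<dots> = \<mu> $ r1" using other by (subst sum.remove[of UNIV r1]) auto
      finally have "\<mu> $ i = 0" for i using other by (cases "i = r1") auto
      with m(1) show False by (simp add: vec_eq_iff)
    qed
  qed measurable
  then show ?thesis by eventually_elim auto
qed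

text \<open>
  The condition on \<open>i\<close> says that \<open>p i\<close> is a convex combination of the other points and that these are affinely
  independent: \<open>gale_vector R $ i \<noteq> 0\<close> is the affine independence, and the quotients
  \<open>- gale_vector R $ j / gale_vector R $ i\<close> are the barycentric coordinates of \<open>p i\<close>. Conversely, the
  vertices of a simplex are extreme points of the hull, hence among the points, and counting leaves exactly one
  index \<open>i\<close> over.
\<close>

lemma simplex_iff_gale_vector:
  fixes R :: "real^'n^'d"
  defines "p \<equiv> (\<lambda>i. \<chi> k. R $ k $ i)"
  shows "int CARD('d) simplex (convex hull (range p)) \<longleftrightarrow>
    (\<exists>i. gale_vector R $ i \<noteq> 0 \<and> (\<forall>j. j \<noteq> i \<longrightarrow> gale_vector R $ j * gale_vector R $ i \<le> 0))"
proof
  have inner_row: "\<mu> \<bullet> (R $ k) = (\<Sum>j\<in>UNIV. \<mu> $ j *\<^sub>R p j) $ k" for \<mu> k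
    by (simp add: inner_vec_def p_def)
  have inner_one: "\<mu> \<bullet> 1 = (\<Sum>j\<in>UNIV. \<mu> $ j)" for \<mu> :: "real^'n"
    by (simp add: inner_vec_def)
  have rel: "(\<Sum>j\<in>UNIV. gale_vector R $ j *\<^sub>R p j) = 0" "(\<Sum>j\<in>UNIV. gale_vector R $ j) = 0"
    using inner_row[of "gale_vector R"] inner_one[of "gale_vector R"] by (simp_all add: vec_eq_iff)
  have unique: "\<mu> = (\<mu> $ i / gale_vector R $ i) *\<^sub>R gale_vector R"
    if "gale_vector R $ i \<noteq> 0" "(\<Sum>j\<in>UNIV. \<mu> $ j) = 0" "(\<Sum>j\<in>UNIV. \<mu> $ j *\<^sub>R p j) = 0" for \<mu> i
    using that by (intro gale_vector_spans_kernel) (simp_all add: inner_row inner_one)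
  {
    assume "\<exists>i. gale_vector R $ i \<noteq> 0 \<and> (\<forall>j. j \<noteq> i \<longrightarrow> gale_vector R $ j * gale_vector R $ i \<le> 0)"
    then obtain i where i: "gale_vector R $ i \<noteq> 0" "\<And>j. j \<noteq> i \<Longrightarrow> gale_vector R $ j * gale_vector R $ i \<le> 0" by blast
    let ?J = "UNIV - {i}" and ?C = "p ` (UNIV - {i})"
    have split: "(\<Sum>j\<in>UNIV. g j) = g i + (\<Sum>j\<in>?J. g j)" for g :: "'n \<Rightarrow> 'z::comm_monoid_add"
      by (rule sum.remove) auto
    have inj: "inj_on p ?J"
    proof (rule inj_onI, rule ccontr)
      fix a b assume ab: "a \<in> ?J" "b \<in> ?J" "p a = p b" "a \<noteq> b"
      define \<mu> :: "real^'n" where "\<mu> = axis a 1 - axis b 1"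
      have sum_axis: "(\<Sum>j\<in>UNIV. axis c (1::real) $ j *\<^sub>R g j) = g c" for c :: 'n and g :: "'n \<Rightarrow> real^'d"
      proof -
        have "(\<Sum>j\<in>UNIV. axis c (1::real) $ j *\<^sub>R g j) = (\<Sum>j\<in>UNIV. if j = c then g j else 0)"
          by (intro sum.cong) (auto simp: axis_def)
        then show ?thesis by simp
      qed
      have "(\<Sum>j\<in>UNIV. \<mu> $ j *\<^sub>R p j) = 0"
        using ab by (simp add: \<mu>_def scaleR_left_diff_distrib sum_subtractf sum_axis)
      moreover have "(\<Sum>j\<in>UNIV. \<mu> $ j) = 0"
        by (simp add: \<mu>_def sum_subtractf axis_def)
      ultimately have "\<mu> = (\<mu> $ i / gale_vector R $ i) *\<^sub>R gale_vector R" by (intro unique i)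
      also have "\<mu> $ i = 0" using ab by (simp add: \<mu>_def axis_def)
      finally have "\<mu> $ a = 0" by simp
      then show False using ab by (simp add: \<mu>_def axis_def)
    qed
    have indep: "\<not> affine_dependent ?C"
    proof
      assume "affine_dependent ?C"
      then obtain U where U: "sum U ?C = 0" "\<exists>v\<in>?C. U v \<noteq> 0" "(\<Sum>v\<in>?C. U v *\<^sub>R v) = 0"
        by (auto simp: affine_dependent_explicit_finite)
      define \<mu> :: "real^'n" where "\<mu> = (\<chi> j. if j = i then 0 else U (p j))"
      have "\<mu> = (\<mu> $ i / gale_vector R $ i) *\<^sub>R gale_vector R"
        using U(1,3) inj by (intro unique i) (simp_all add: \<mu>_def split sum.reindex comp_def)
      also have "\<mu> $ i = 0" by (simp add: \<mu>_def)
      finally have zero: "\<mu> $ j = 0" for j by simp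
      have "U (p j) = 0" if "j \<noteq> i" for j using that zero[of j] by (simp add: \<mu>_def)
      then show False using U(2) by auto
    qed
    have "card ?C = CARD('d) + 1"
      using card_image[OF inj] card_n by (simp add: card_Diff_subset)
    then have "int CARD('d) simplex (convex hull ?C)"
      using indep by (intro simplex_convex_hull) simp
    moreover have "p i \<in> convex hull ?C"
    proof -
      let ?w = "\<lambda>j. - gale_vector R $ j / gale_vector R $ i"
      have "(\<Sum>j\<in>?J. ?w j *\<^sub>R p j) \<in> convex hull ?C"
      proof (rule convex_sum)
        show "sum ?w ?J = 1"
          using rel(2) i(1) by (simp add: split sum_divide_distrib[symmetric] sum_negf field_simps)
        show "0 \<le> ?w j" if "j \<in> ?J" for j
        proof -
          have "?w j = - (gale_vector R $ j * gale_vector R $ i) / (gale_vector R $ i)\<^sup>2"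
            using i(1) by (simp add: power2_eq_square)
          also have "\<dots> \<ge> 0" using i(2)[of j] that by (intro divide_nonneg_nonneg) auto
          finally show ?thesis .
        qed
        show "p j \<in> convex hull ?C" if "j \<in> ?J" for j using that by (simp add: hull_inc)
      qed auto
      also have "(\<Sum>j\<in>?J. ?w j *\<^sub>R p j) = (- 1 / gale_vector R $ i) *\<^sub>R (\<Sum>j\<in>?J. gale_vector R $ j *\<^sub>R p j)"
        by (simp add: scaleR_sum_right)
      also have "(\<Sum>j\<in>?J. gale_vector R $ j *\<^sub>R p j) = - (gale_vector R $ i *\<^sub>R p i)"
        using rel(1) by (simp add: split eq_neg_iff_add_eq_0 add.commute)
      finally show ?thesis using i(1) by simp
    qed
    then have "convex hull (insert (p i) ?C) = convex hull ?C" by (rule hull_redundant)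
    moreover have "insert (p i) ?C = range p" by auto
    ultimately show "int CARD('d) simplex (convex hull (range p))" by simp
  }
  {
    assume "int CARD('d) simplex (convex hull (range p))"
    then obtain C where C: "finite C" "\<not> affine_dependent C" "card C = CARD('d) + 1"
      "convex hull (range p) = convex hull C"
      by (auto simp: simplex)
    have "C \<subseteq> range p"
      using extreme_point_of_convex_hull_affine_independent[OF C(2)] C(4) extreme_point_of_convex_hull
      by (metis subsetI)
    define g where "g = inv_into UNIV p"
    have g: "p (g c) = c" if "c \<in> C" for c
      using \<open>C \<subseteq> range p\<close> that by (auto simp: g_def f_inv_into_f)
    have inj_g: "inj_on g C" by (rule inj_on_inverseI[of _ p]) (rule g)
    have "card (UNIV - g ` C) = 1"
      using card_image[OF inj_g] C(1,3) card_n by (simp add: card_Diff_subset)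
    then obtain i where i: "UNIV - g ` C = {i}" by (auto simp: card_1_singleton_iff)
    then have J: "UNIV - {i} = g ` C" "i \<notin> g ` C" by auto
    have split: "(\<Sum>j\<in>UNIV. h j) = h i + (\<Sum>c\<in>C. h (g c))" for h :: "'n \<Rightarrow> 'z::comm_monoid_add"
      using sum.remove[of UNIV i h] by (simp add: J sum.reindex[OF inj_g] comp_def)
    have li: "gale_vector R $ i \<noteq> 0"
    proof
      assume "gale_vector R $ i = 0"
      then obtain \<mu> where m: "\<mu> \<noteq> 0" "\<mu> $ i = 0" "\<mu> \<bullet> 1 = 0" "\<And>k. \<mu> \<bullet> (R $ k) = 0"
        by (rule kernel_if_gale_vector_eq_0) blast
      have "(\<Sum>j\<in>UNIV. \<mu> $ j *\<^sub>R p j) = 0" using m(4) by (simp add: inner_row vec_eq_iff)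
      then have "(\<Sum>c\<in>C. \<mu> $ g c *\<^sub>R c) = 0" using m(2) by (simp add: split g)
      moreover have "(\<Sum>c\<in>C. \<mu> $ g c) = 0" using m(2,3) by (simp add: inner_one split)
      moreover obtain j where "\<mu> $ j \<noteq> 0" using m(1) by (auto simp: vec_eq_iff)
      then have "j \<in> g ` C" using m(2) J by auto
      then have "\<exists>c\<in>C. \<mu> $ g c \<noteq> 0" using \<open>\<mu> $ j \<noteq> 0\<close> by auto
      ultimately have "affine_dependent C"
        using C(1) by (auto simp: affine_dependent_explicit_finite intro!: exI[of _ "\<lambda>c. \<mu> $ g c"])
      with C(2) show False ..
    qed
    have "p i \<in> convex hull C" using C(4) by (metis hull_inc rangeI)
    then obtain u where u: "\<And>c. c \<in> C \<Longrightarrow> 0 \<le> u c" "sum u C = 1" "(\<Sum>c\<in>C. u c *\<^sub>R c) = p i"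
      using convex_hull_finite[OF C(1)] by auto
    define \<mu> :: "real^'n" where "\<mu> = (\<chi> j. if j = i then - 1 else u (p j))"
    have mu_g: "\<mu> $ g c = u c" if "c \<in> C" for c using that J g by (auto simp: \<mu>_def)
    have mu_i: "\<mu> $ i = - 1" by (simp add: \<mu>_def)
    have "\<mu> = (\<mu> $ i / gale_vector R $ i) *\<^sub>R gale_vector R"
      using u by (intro unique li) (simp_all add: split mu_g mu_i g)
    from arg_cong[OF this, of "\<lambda>v. v $ _"]
    have mu: "\<mu> $ j = - gale_vector R $ j / gale_vector R $ i" for j by (simp add: mu_i)
    have "gale_vector R $ j * gale_vector R $ i \<le> 0" if "j \<noteq> i" for j
    proof -
      have "j \<in> g ` C" using that J by auto
      then have "0 \<le> \<mu> $ j" using mu_g u(1) by auto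
      then have "0 \<le> \<mu> $ j * (gale_vector R $ i)\<^sup>2" by simp
      also have "\<dots> = - (gale_vector R $ j * gale_vector R $ i)" using li by (simp add: mu power2_eq_square)
      finally show ?thesis by simp
    qed
    then show "\<exists>i. gale_vector R $ i \<noteq> 0 \<and> (\<forall>j. j \<noteq> i \<longrightarrow> gale_vector R $ j * gale_vector R $ i \<le> 0)"
      using li by (intro exI[of _ i]) auto
  }
qed

end

section \<open>The rows of a Gaussian sample\<close>

lemma prod_Basis_vec:
  fixes f :: "('a::euclidean_space)^'k \<Rightarrow> 'b::comm_monoid_mult"
  shows "(\<Prod>b\<in>Basis. f b) = (\<Prod>k\<in>UNIV. \<Prod>u\<in>Basis. f (axis k u))"
proof -
  have eq: "Basis = (\<lambda>(k, u). axis k u :: 'a^'k) ` (UNIV \<times> Basis)"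
    by (auto simp: Basis_vec_def)
  have inj: "inj_on (\<lambda>(k, u). axis k u :: 'a^'k) (UNIV \<times> Basis)"
    by (auto simp: inj_on_def axis_eq_axis nonzero_Basis)
  show ?thesis
    unfolding eq prod.reindex[OF inj] by (simp add: prod.cartesian_product case_prod_beta' comp_def)
qed

lemma measurable_vec_nth_borel [measurable]:
  "(\<lambda>x::('a::euclidean_space)^'k. x $ k) \<in> borel_measurable borel"
  by (intro borel_measurable_continuous_onI continuous_intros)

lemma norm_power2_vec: "(norm (x :: ('a::real_inner)^'k))\<^sup>2 = (\<Sum>k\<in>UNIV. (norm (x $ k))\<^sup>2)"
  by (simp add: power2_norm_eq_inner inner_vec_def)

lemma PiM_std_gauss:
  assumes I: "finite I"
  shows "(\<Pi>\<^sub>M i\<in>I. (std_gauss :: 'a::euclidean_space measure))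
    = density (\<Pi>\<^sub>M i\<in>I. lborel) (\<lambda>f. \<Prod>i\<in>I. ennreal (std_gauss_density (f i)))"
proof -
  interpret L: product_sigma_finite "\<lambda>_. lborel :: 'a measure" ..
  interpret G: prob_space "std_gauss :: 'a measure" by (rule prob_space_std_gauss)
  interpret product_sigma_finite "\<lambda>_. std_gauss :: 'a measure" ..
  let ?P = "\<Pi>\<^sub>M i\<in>I. (lborel :: 'a measure)"
  show ?thesis
  proof (rule PiM_eqI[symmetric, OF I])
    show "sets (density ?P (\<lambda>f. \<Prod>i\<in>I. ennreal (std_gauss_density (f i)))) = sets (\<Pi>\<^sub>M i\<in>I. (std_gauss :: 'a measure))"
      unfolding sets_density by (rule sets_PiM_cong) auto
    fix A :: "_ \<Rightarrow> 'a set" assume A: "\<And>i. i \<in> I \<Longrightarrow> A i \<in> sets std_gauss"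
    then have A': "\<And>i. i \<in> I \<Longrightarrow> A i \<in> sets borel" by simp
    have PA: "Pi\<^sub>E I A \<in> sets ?P" using A' by (intro sets_PiM_I_finite I) auto
    have "emeasure (density ?P (\<lambda>f. \<Prod>i\<in>I. ennreal (std_gauss_density (f i)))) (Pi\<^sub>E I A)
        = (\<integral>\<^sup>+f. (\<Prod>i\<in>I. ennreal (std_gauss_density (f i))) * indicator (Pi\<^sub>E I A) f \<partial>?P)"
      by (rule emeasure_density[OF _ PA]) measurable
    also have "\<dots> = (\<integral>\<^sup>+f. (\<Prod>i\<in>I. ennreal (std_gauss_density (f i)) * indicator (A i) (f i)) \<partial>?P)"
    proof (rule nn_integral_cong)
      fix f assume "f \<in> space ?P"
      then have "indicator (Pi\<^sub>E I A) f = (\<Prod>i\<in>I. indicator (A i) (f i) :: ennreal)"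
        using I by (auto simp: indicator_def space_PiM PiE_def Pi_def)
      then show "(\<Prod>i\<in>I. ennreal (std_gauss_density (f i))) * indicator (Pi\<^sub>E I A) f
          = (\<Prod>i\<in>I. ennreal (std_gauss_density (f i)) * indicator (A i) (f i))"
        by (simp add: prod.distrib)
    qed
    also have "\<dots> = (\<Prod>i\<in>I. \<integral>\<^sup>+x. ennreal (std_gauss_density x) * indicator (A i) x \<partial>lborel)"
    proof (rule L.product_nn_integral_prod[OF I])
      fix i assume "i \<in> I"
      with A' have [measurable]: "A i \<in> sets borel" by simp
      show "(\<lambda>x. ennreal (std_gauss_density x) * indicator (A i) x) \<in> borel_measurable lborel" by measurable
    qed
    also have "\<dots> = (\<Prod>i\<in>I. emeasure std_gauss (A i))"
      unfolding std_gauss_def using A' by (intro prod.cong refl emeasure_density[symmetric]) auto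
    finally show "emeasure (density ?P (\<lambda>f. \<Prod>i\<in>I. ennreal (std_gauss_density (f i)))) (Pi\<^sub>E I A)
        = (\<Prod>i\<in>I. emeasure std_gauss (A i))" .
  qed
qed

context
  fixes I :: "'i set" and idx :: "'n::finite \<Rightarrow> 'i"
  assumes I: "finite I" and idx: "bij_betw idx UNIV I"
begin

text \<open>
  Sampling by rows: points indexed by \<open>I\<close> are relabelled by \<open>'n\<close> and transposed, so that an isometry of
  \<open>real^'n\<close> acts on every row separately.
\<close>

definition rows_of :: "('i \<Rightarrow> real^'d) \<Rightarrow> real^'n^'d" where
  "rows_of x = (\<chi> k i. x (idx i) $ k)"

lemma idx_mem: "idx i \<in> I" using idx by (auto simp: bij_betw_def)

lemma measurable_rows_of [measurable]: "rows_of \<in> (\<Pi>\<^sub>M i\<in>I. borel) \<rightarrow>\<^sub>M borel"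
proof (subst borel_measurable_euclidean_space, intro ballI)
  fix b :: "real^'n^'d" assume "b \<in> Basis"
  then obtain k i where b: "b = axis k (axis i 1)" by (auto simp: Basis_vec_def)
  have [measurable]: "(\<lambda>x. x (idx i)) \<in> (\<Pi>\<^sub>M i\<in>I. borel) \<rightarrow>\<^sub>M (borel :: (real^'d) measure)"
    by (rule measurable_component_singleton[OF idx_mem])
  show "(\<lambda>x. rows_of x \<bullet> b) \<in> borel_measurable (\<Pi>\<^sub>M i\<in>I. borel)"
    unfolding b rows_of_def inner_axis vec_lambda_beta by measurable
qed

lemma distr_PiM_lborel_rows_of:
  "distr (\<Pi>\<^sub>M i\<in>I. lborel) borel rows_of = (lborel :: (real^'n^'d) measure)"
proof (rule lborel_eqI[symmetric])
  interpret product_sigma_finite "\<lambda>_. lborel :: (real^'d) measure" ..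
  let ?P = "\<Pi>\<^sub>M i\<in>I. (lborel :: (real^'d) measure)"
  have [measurable]: "rows_of \<in> ?P \<rightarrow>\<^sub>M borel"
    using measurable_rows_of by (simp cong: measurable_cong_sets sets_PiM_cong)
  fix l u :: "real^'n^'d" assume lu: "\<And>b. b \<in> Basis \<Longrightarrow> l \<bullet> b \<le> u \<bullet> b"
  let ?c = "\<lambda>(w :: real^'n^'d) m. (\<chi> k. w $ k $ inv idx m) :: real^'d"
  have inv: "inv idx (idx i) = i" for i using idx by (simp add: bij_betw_def inv_f_f)
  have mem: "x \<in> box (l :: real^'n^'d) u \<longleftrightarrow> (\<forall>k i. l $ k $ i < x $ k $ i \<and> x $ k $ i < u $ k $ i)" for x l u
    by (auto simp: mem_box Basis_vec_def inner_axis)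
  have mem': "x \<in> box (l :: real^'d) u \<longleftrightarrow> (\<forall>k. l $ k < x $ k \<and> x $ k < u $ k)" for x l u
    by (auto simp: mem_box Basis_vec_def inner_axis)
  have I_eq: "I = idx ` UNIV" using idx by (simp add: bij_betw_def)
  have "rows_of -` box l u \<inter> space ?P = Pi\<^sub>E I (\<lambda>m. box (?c l m) (?c u m))"
    unfolding I_eq by (auto simp: mem mem' rows_of_def space_PiM PiE_iff inv)
  then have "emeasure (distr ?P borel rows_of) (box l u) = emeasure ?P (Pi\<^sub>E I (\<lambda>m. box (?c l m) (?c u m)))"
    by (subst emeasure_distr) auto
  also have "\<dots> = (\<Prod>m\<in>I. emeasure lborel (box (?c l m) (?c u m)))"
    by (rule emeasure_PiM[OF I]) auto
  also have "\<dots> = (\<Prod>i\<in>UNIV. emeasure lborel (box (?c l (idx i)) (?c u (idx i))))"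
    using idx by (intro prod.reindex_bij_betw[symmetric])
  also have "\<dots> = (\<Prod>i\<in>UNIV. ennreal (\<Prod>k\<in>UNIV. u $ k $ i - l $ k $ i))"
  proof (intro prod.cong refl)
    fix i
    have le: "l $ k $ i \<le> u $ k $ i" for k
      using lu[of "axis k (axis i 1)"] by (auto simp: Basis_vec_def inner_axis)
    have "emeasure lborel (box (?c l (idx i)) (?c u (idx i))) = ennreal (\<Prod>b\<in>Basis. (?c u (idx i) - ?c l (idx i)) \<bullet> b)"
      using le by (intro emeasure_lborel_box) (auto simp: Basis_vec_def inner_axis inv)
    also have "(\<Prod>b\<in>Basis. (?c u (idx i) - ?c l (idx i)) \<bullet> b) = (\<Prod>k\<in>UNIV. u $ k $ i - l $ k $ i)"
      by (simp add: prod_Basis_vec inner_axis inv)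
    finally show "emeasure lborel (box (?c l (idx i)) (?c u (idx i))) = ennreal (\<Prod>k\<in>UNIV. u $ k $ i - l $ k $ i)" .
  qed
  also have "\<dots> = ennreal (\<Prod>i\<in>UNIV. \<Prod>k\<in>UNIV. u $ k $ i - l $ k $ i)"
  proof (rule prod_ennreal)
    fix i
    show "0 \<le> (\<Prod>k\<in>UNIV. u $ k $ i - l $ k $ i)"
      using lu[of "axis _ (axis i 1)"] by (intro prod_nonneg) (auto simp: Basis_vec_def inner_axis)
  qed
  also have "(\<Prod>i\<in>UNIV. \<Prod>k\<in>UNIV. u $ k $ i - l $ k $ i) = (\<Prod>k\<in>UNIV. \<Prod>i\<in>UNIV. u $ k $ i - l $ k $ i)"
    by (rule prod.swap)
  also have "\<dots> = (\<Prod>b\<in>Basis. (u - l) \<bullet> b)"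
    by (simp add: prod_Basis_vec inner_axis)
  finally show "emeasure (distr ?P borel rows_of) (box l u) = ennreal (\<Prod>b\<in>Basis. (u - l) \<bullet> b)" .
qed simp

lemma distr_PiM_std_gauss_rows_of:
  "distr (\<Pi>\<^sub>M i\<in>I. std_gauss) borel rows_of = (std_gauss :: (real^'n^'d) measure)"
proof -
  let ?P = "\<Pi>\<^sub>M i\<in>I. (lborel :: (real^'d) measure)"
  have [measurable]: "rows_of \<in> ?P \<rightarrow>\<^sub>M borel"
    using measurable_rows_of by (simp cong: measurable_cong_sets sets_PiM_cong)
  have dens: "ennreal (std_gauss_density (rows_of x :: real^'n^'d)) = (\<Prod>i\<in>I. ennreal (std_gauss_density (x i)))" for x :: "'i \<Rightarrow> real^'d"
  proof -
    have "(norm (rows_of x :: real^'n^'d))\<^sup>2 = (\<Sum>k\<in>UNIV. \<Sum>i\<in>UNIV. (x (idx i) $ k)\<^sup>2)"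
      by (simp add: norm_power2_vec rows_of_def)
    also have "\<dots> = (\<Sum>i\<in>UNIV. \<Sum>k\<in>UNIV. (x (idx i) $ k)\<^sup>2)" by (rule sum.swap)
    also have "\<dots> = (\<Sum>i\<in>UNIV. (norm (x (idx i)))\<^sup>2)" by (simp add: norm_power2_vec)
    also have "\<dots> = (\<Sum>m\<in>I. (norm (x m))\<^sup>2)" by (rule sum.reindex_bij_betw[OF idx])
    finally have n: "(norm (rows_of x :: real^'n^'d))\<^sup>2 = (\<Sum>m\<in>I. (norm (x m))\<^sup>2)" .
    have "card I = CARD('n)" using bij_betw_same_card[OF idx] by simp
    then have "std_gauss_density (rows_of x :: real^'n^'d) = (\<Prod>i\<in>I. std_gauss_density (x i))"
      using I by (simp add: std_gauss_density_def n prod_dividef exp_sum[symmetric] sum_negf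
          sum_divide_distrib power_mult mult.commute)
    then show ?thesis by (simp add: prod_ennreal)
  qed
  have "distr (\<Pi>\<^sub>M i\<in>I. std_gauss) borel rows_of
      = distr (density ?P (\<lambda>x. ennreal (std_gauss_density (rows_of x :: real^'n^'d)))) borel rows_of"
    by (simp add: PiM_std_gauss[OF I] dens)
  also have "\<dots> = density (distr ?P borel rows_of) (\<lambda>R. ennreal (std_gauss_density R))"
    by (rule density_distr[symmetric]) measurable
  also have "\<dots> = std_gauss" by (simp add: distr_PiM_lborel_rows_of std_gauss_def)
  finally show ?thesis .
qed

lemma joint_law_rows:
  fixes M :: "'w measure" and X :: "'i \<Rightarrow> 'w \<Rightarrow> real^'d"
  assumes M: "prob_space M" and indep: "prob_space.indep_vars M (\<lambda>_. borel) X I"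
    and dist: "\<And>i. i \<in> I \<Longrightarrow> distributed M lborel (X i) (\<lambda>x. ennreal (std_gauss_density x))"
  shows "(\<lambda>\<omega>. rows_of (\<lambda>i. X i \<omega>)) \<in> M \<rightarrow>\<^sub>M borel"
    and "distr M borel (\<lambda>\<omega>. rows_of (\<lambda>i. X i \<omega>)) = std_gauss"
proof -
  interpret prob_space M by fact
  have rv: "random_variable borel (X i)" if "i \<in> I" for i
    using distributed_measurable[OF dist[OF that]] by simp
  have law: "distr M borel (X i) = std_gauss" if "i \<in> I" for i
  proof -
    have "distr M borel (X i) = distr M lborel (X i)" by (rule distr_cong) auto
    also have "\<dots> = std_gauss"
      using distributed_distr_eq_density[OF dist[OF that]] by (simp add: std_gauss_def)
    finally show ?thesis .
  qed
  have restr: "rows_of (\<lambda>i. X i \<omega>) = rows_of (\<lambda>i\<in>I. X i \<omega>)" for \<omega>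
    by (simp add: rows_of_def idx_mem)
  have m: "(\<lambda>\<omega>. \<lambda>i\<in>I. X i \<omega>) \<in> M \<rightarrow>\<^sub>M (\<Pi>\<^sub>M i\<in>I. borel)"
    using rv by (intro measurable_restrict)
  then show "(\<lambda>\<omega>. rows_of (\<lambda>i. X i \<omega>)) \<in> M \<rightarrow>\<^sub>M borel"
    unfolding restr by measurable
  have "I \<noteq> {}" using idx_mem by auto
  have "distr M borel (\<lambda>\<omega>. rows_of (\<lambda>i. X i \<omega>)) = distr (distr M (\<Pi>\<^sub>M i\<in>I. borel) (\<lambda>\<omega>. \<lambda>i\<in>I. X i \<omega>)) borel rows_of"
    unfolding restr using m by (subst distr_distr) (auto simp: comp_def)
  also have "distr M (\<Pi>\<^sub>M i\<in>I. borel) (\<lambda>\<omega>. \<lambda>i\<in>I. X i \<omega>) = (\<Pi>\<^sub>M i\<in>I. distr M borel (X i))"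
    using indep indep_vars_iff_distr_eq_PiM'[OF \<open>I \<noteq> {}\<close> rv] by simp
  also have "\<dots> = (\<Pi>\<^sub>M i\<in>I. std_gauss)" using law by (intro PiM_cong) auto
  finally show "distr M borel (\<lambda>\<omega>. rows_of (\<lambda>i. X i \<omega>)) = std_gauss"
    by (simp add: distr_PiM_std_gauss_rows_of)
qed

end

section \<open>The vertex cone of the regular simplex\<close>

text \<open>
  The positive hull of the edge vectors \<open>b - b1\<close> at the vertex \<open>b1\<close> of the regular simplex, described by
  inequalities; see \<open>pos_hull_eq_vertex_cone\<close>.
\<close>

definition vertex_cone :: "'a::euclidean_space \<Rightarrow> 'a set" where
  "vertex_cone b1 = {x. x \<bullet> One = 0 \<and> (\<forall>b\<in>Basis - {b1}. 0 \<le> x \<bullet> b)}"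

lemma inner_One: "x \<bullet> One = (\<Sum>b\<in>Basis. x \<bullet> b)"
  by (simp add: inner_sum_right)

lemma inner_Basis_One: "b \<in> Basis \<Longrightarrow> b \<bullet> One = 1"
  by (simp add: inner_sum_right inner_Basis)

lemma inner_One_Basis: "b \<in> Basis \<Longrightarrow> One \<bullet> b = 1"
  by (metis inner_Basis_One inner_commute)

lemma subspace_zero_sum: "subspace {x. x \<bullet> One = 0}"
  by (simp add: subspace_def inner_add_left)

lemma closed_vertex_cone: "closed (vertex_cone b1)"
proof -
  have "vertex_cone b1 = {x. x \<bullet> One = 0} \<inter> (\<Inter>b\<in>Basis - {b1}. {x. 0 \<le> x \<bullet> b})"
    by (auto simp: vertex_cone_def)
  then show ?thesis
    by (auto intro!: closed_Int closed_INT closed_Collect_eq closed_Collect_le continuous_intros)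
qed

text \<open>
  The coefficients in the positive hull are the coordinates away from \<open>b1\<close>; the coordinate at \<open>b1\<close> is forced by
  the vanishing sum.
\<close>

lemma vertex_cone_expansion:
  assumes b1: "b1 \<in> Basis" and x: "x \<bullet> One = 0"
  shows "x = (\<Sum>b\<in>Basis - {b1}. (x \<bullet> b) *\<^sub>R (b - b1))"
proof -
  have "(\<Sum>b\<in>Basis. x \<bullet> b) = x \<bullet> b1 + (\<Sum>b\<in>Basis - {b1}. x \<bullet> b)"
    using b1 by (intro sum.remove) auto
  then have s: "(\<Sum>b\<in>Basis - {b1}. x \<bullet> b) = - (x \<bullet> b1)" using x by (simp add: inner_One)
  have "x = (\<Sum>b\<in>Basis. (x \<bullet> b) *\<^sub>R b)" by (rule euclidean_representation[symmetric])
  also have "\<dots> = (x \<bullet> b1) *\<^sub>R b1 + (\<Sum>b\<in>Basis - {b1}. (x \<bullet> b) *\<^sub>R b)"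
    using b1 by (intro sum.remove) auto
  also have "\<dots> = (\<Sum>b\<in>Basis - {b1}. (x \<bullet> b) *\<^sub>R (b - b1))"
    using s by (simp add: scaleR_diff_right sum_subtractf scaleR_left.sum[symmetric])
  finally show ?thesis .
qed

lemma pos_hull_eq_vertex_cone:
  fixes b1 :: "'a::euclidean_space"
  assumes b1: "b1 \<in> Basis"
  shows "pos_hull ((\<lambda>b. b - b1) ` (Basis - {b1})) = vertex_cone b1"
proof -
  let ?I = "Basis - {b1}"
  have inj: "inj_on (\<lambda>b. b - b1) ?I" by (auto simp: inj_on_def)
  have hull: "pos_hull ((\<lambda>b. b - b1) ` ?I) = {\<Sum>b\<in>?I. c (b - b1) *\<^sub>R (b - b1) | c. \<forall>b\<in>?I. 0 \<le> c (b - b1)}"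
    unfolding pos_hull_def by (simp add: sum.reindex[OF inj] comp_def)
  have one: "(\<Sum>b\<in>?I. c b *\<^sub>R (b - b1)) \<bullet> One = 0" for c :: "'a \<Rightarrow> real"
    using b1 by (simp add: inner_sum_left inner_diff_left inner_Basis_One)
  have coord: "(\<Sum>b\<in>?I. c b *\<^sub>R (b - b1)) \<bullet> b' = c b'" if b': "b' \<in> ?I" for b' and c :: "'a \<Rightarrow> real"
  proof -
    have "(\<Sum>b\<in>?I. c b *\<^sub>R (b - b1)) \<bullet> b' = (\<Sum>b\<in>?I. if b = b' then c b else 0)"
      unfolding inner_sum_left using b1 b' by (intro sum.cong) (auto simp: inner_diff_left inner_Basis)
    then show ?thesis using b' by (simp add: sum.delta)
  qed
  show ?thesis
  proof (intro set_eqI iffI)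
    fix x assume "x \<in> pos_hull ((\<lambda>b. b - b1) ` ?I)"
    then obtain c where "x = (\<Sum>b\<in>?I. c (b - b1) *\<^sub>R (b - b1))" "\<forall>b\<in>?I. 0 \<le> c (b - b1)"
      unfolding hull by blast
    then show "x \<in> vertex_cone b1"
      using one[of "\<lambda>b. c (b - b1)"] coord[of _ "\<lambda>b. c (b - b1)"] by (simp add: vertex_cone_def)
  next
    fix x assume x: "x \<in> vertex_cone b1"
    define c where "c v = x \<bullet> (v + b1)" for v
    have "x = (\<Sum>b\<in>?I. c (b - b1) *\<^sub>R (b - b1))"
      using vertex_cone_expansion[OF b1, of x] x by (simp add: c_def vertex_cone_def)
    moreover have "\<forall>b\<in>?I. 0 \<le> c (b - b1)" using x by (simp add: c_def vertex_cone_def)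
    ultimately show "x \<in> pos_hull ((\<lambda>b. b - b1) ` ?I)" unfolding hull by blast
  qed
qed

lemma span_vertex_cone:
  fixes b1 :: "'a::euclidean_space"
  assumes b1: "b1 \<in> Basis"
  shows "span (vertex_cone b1) = {x. x \<bullet> One = 0}"
proof
  show "span (vertex_cone b1) \<subseteq> {x. x \<bullet> One = 0}"
    by (rule span_minimal[OF _ subspace_zero_sum]) (auto simp: vertex_cone_def)
  have mem: "b - b1 \<in> vertex_cone b1" if "b \<in> Basis - {b1}" for b
    using that b1 by (auto simp: vertex_cone_def inner_diff_left inner_Basis_One inner_Basis)
  show "{x. x \<bullet> One = 0} \<subseteq> span (vertex_cone b1)"
  proof
    fix x :: 'a assume "x \<in> {x. x \<bullet> One = 0}"
    then have "x = (\<Sum>b\<in>Basis - {b1}. (x \<bullet> b) *\<^sub>R (b - b1))"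
      using vertex_cone_expansion[OF b1] by simp
    also have "\<dots> \<in> span (vertex_cone b1)" using mem by (intro span_sum span_scale span_base)
    finally show "x \<in> span (vertex_cone b1)" .
  qed
qed

text \<open>
  The orthogonal projection to the hyperplane of vectors with zero coordinate sum.
\<close>

definition center :: "'a::euclidean_space \<Rightarrow> 'a" where
  "center z = z - ((z \<bullet> One) / real DIM('a)) *\<^sub>R One"

lemma One_inner_One: "(One :: 'a::euclidean_space) \<bullet> One = real DIM('a)"
  unfolding inner_One by (simp add: inner_One_Basis)

lemma center_inner_One: "center (z :: 'a::euclidean_space) \<bullet> One = 0"
  by (simp add: center_def inner_diff_left One_inner_One)

lemma center_inner_Basis: "b \<in> Basis \<Longrightarrow> center (z :: 'a::euclidean_space) \<bullet> b = z \<bullet> b - (\<Sum>c\<in>Basis. z \<bullet> c) / real DIM('a)"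
  by (simp add: center_def inner_diff_left inner_One_Basis inner_One)

lemma measurable_center [measurable]: "center \<in> borel_measurable borel"
  unfolding center_def[abs_def] by measurable

definition center_gauss :: "'a::euclidean_space measure" where
  "center_gauss = distr std_gauss borel center"

text \<open>
  A reflection along a vector of the hyperplane fixes \<open>One\<close> and so commutes with the projection. A coordinate
  of the projection is the inner product with the projected basis vector, which is nonzero from dimension 2 on.
\<close>

lemma center_gauss_properties:
  fixes v :: "'a::euclidean_space"
  shows prob_space_center_gauss: "prob_space (center_gauss :: 'a measure)"
    and sets_center_gauss: "sets (center_gauss :: 'a measure) = sets borel"
    and AE_center_gauss_zero_sum: "AE x in (center_gauss :: 'a measure). x \<bullet> One = 0"
    and AE_center_gauss_coord: "DIM('a) \<ge> 2 \<Longrightarrow> b \<in> Basis \<Longrightarrow> AE x in (center_gauss :: 'a measure). x \<bullet> b \<noteq> 0"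
    and center_gauss_reflect: "v \<bullet> One = 0 \<Longrightarrow> distr center_gauss borel (reflect v) = center_gauss"
proof -
  interpret prob_space "std_gauss :: 'a measure" by (rule prob_space_std_gauss)
  show "prob_space (center_gauss :: 'a measure)"
    unfolding center_gauss_def by (rule prob_space_distr) measurable
  show "sets (center_gauss :: 'a measure) = sets borel" by (simp add: center_gauss_def)
  show "AE x in (center_gauss :: 'a measure). x \<bullet> One = 0"
    unfolding center_gauss_def by (subst AE_distr_iff) (auto simp: center_inner_One)
  show "AE x in (center_gauss :: 'a measure). x \<bullet> b \<noteq> 0" if dim: "DIM('a) \<ge> 2" and b: "b \<in> Basis"
  proof -
    define a :: 'a where "a = b - (1 / real DIM('a)) *\<^sub>R One"
    have eq: "center z \<bullet> b = z \<bullet> a" for z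
      by (simp add: center_inner_Basis[OF b] a_def inner_diff_right inner_One[symmetric])
    have "a \<bullet> b = 1 - 1 / real DIM('a)"
      using b by (simp add: a_def inner_diff_left inner_One_Basis)
    then have "a \<noteq> 0" using dim by auto
    from AE_std_gauss_not_orthogonal[OF this] show ?thesis
      unfolding center_gauss_def by (subst AE_distr_iff) (auto simp: eq)
  qed
  assume v: "v \<bullet> One = 0"
  have R1: "reflect v One = One" using v by (simp add: reflect_def inner_commute[of One v])
  have "reflect v z \<bullet> One = z \<bullet> One" for z :: 'a
    using inner_reflect[of v z One] by (simp add: R1 del: inner_reflect)
  then have comm: "reflect v (center z) = center (reflect v z)" for z
    by (simp add: center_def linear_diff[OF linear_reflect] linear_cmul[OF linear_reflect] R1)
  have "distr center_gauss borel (reflect v) = distr std_gauss borel (\<lambda>z. reflect v (center z))"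
    unfolding center_gauss_def by (subst distr_distr) (auto simp: comp_def)
  also have "\<dots> = distr (distr std_gauss borel (reflect v)) borel center"
    unfolding comm by (subst distr_distr) (auto simp: comp_def)
  also have "\<dots> = center_gauss"
    by (simp add: distr_std_gauss_isometry[OF orthogonal_transformation_reflect] center_gauss_def)
  finally show "distr center_gauss borel (reflect v) = center_gauss" .
qed

lemma measure_center_gauss_vertex_cone:
  fixes b1 :: "'a::euclidean_space"
  assumes b1: "b1 \<in> Basis"
  shows "complex_of_real (measure center_gauss (vertex_cone b1)) = complex_of_real (1 / sqrt (2 * pi)) *
      (\<integral>x. Phi (\<i> * complex_of_real (x / sqrt (real DIM('a)))) ^ (DIM('a) - 1) * complex_of_real (exp (- x\<^sup>2 / 2)) \<partial>lborel)"
proof -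
  have [measurable]: "vertex_cone b1 \<in> sets borel" using closed_vertex_cone by (rule borel_closed)
  have "measure center_gauss (vertex_cone b1) = measure std_gauss (center -` vertex_cone b1)"
    unfolding center_gauss_def by (subst measure_distr) auto
  also have "center -` vertex_cone b1 = {z. \<forall>b\<in>Basis - {b1}. (\<Sum>c\<in>Basis. z \<bullet> c) / real DIM('a) \<le> z \<bullet> b}"
    by (auto simp: vertex_cone_def center_inner_One center_inner_Basis)
  finally show ?thesis using measure_gauss_above_mean[OF b1] by simp
qed

text \<open>
  The centred Gaussian serves as the reference measure: the direction of the affine relation and the uniform
  distribution on the ball are both compared with it.
\<close>

lemma reflection_invariant_eq_center_gauss:
  fixes \<mu> :: "'a::euclidean_space measure"
  assumes dim: "DIM('a) \<ge> 2" and mu: "prob_space \<mu>" "sets \<mu> = sets borel"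
    and AE: "AE x in \<mu>. x \<in> {x. x \<bullet> One = 0} - {0}"
    and inv: "\<And>v. v \<bullet> One = 0 \<Longrightarrow> distr \<mu> borel (reflect v) = \<mu>"
    and K: "K \<in> sets borel" and cone: "\<And>c x. 0 < c \<Longrightarrow> x \<in> K \<Longrightarrow> c *\<^sub>R x \<in> K"
  shows "measure \<mu> K = measure center_gauss K"
proof (rule reflection_invariant_cone_unique[OF mu(1) prob_space_center_gauss mu(2) sets_center_gauss subspace_zero_sum AE _ _ _ K cone])
  obtain b :: 'a where b: "b \<in> Basis" using nonempty_Basis by blast
  show "AE x in (center_gauss :: 'a measure). x \<in> {x. x \<bullet> One = 0} - {0}"
    using AE_center_gauss_zero_sum AE_center_gauss_coord[OF dim b] by eventually_elim auto
qed (use inv center_gauss_reflect in auto)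

lemma vertex_cone_scale: "0 < c \<Longrightarrow> x \<in> vertex_cone b1 \<Longrightarrow> c *\<^sub>R x \<in> vertex_cone b1"
  by (auto simp: vertex_cone_def)

text \<open>
  Uniform distribution on the ball and centred Gaussian are both reflection-invariant, so they agree on the cone.
\<close>

theorem solid_angle_vertex_cone:
  fixes b1 :: "'a::euclidean_space"
  assumes b1: "b1 \<in> Basis" and dim: "DIM('a) \<ge> 2"
  shows "solid_angle (vertex_cone b1) = measure center_gauss (vertex_cone b1)"
proof -
  let ?L = "{x :: 'a. x \<bullet> One = 0}"
  have [measurable]: "vertex_cone b1 \<in> sets borel" using closed_vertex_cone by (rule borel_closed)
  have "\<exists>b2\<in>Basis. b2 \<noteq> b1"
  proof (rule ccontr)
    assume "\<not> (\<exists>b2\<in>Basis. b2 \<noteq> b1)"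
    then have "Basis \<subseteq> {b1}" by auto
    then have "DIM('a) \<le> 1" using card_mono[of "{b1}" "Basis :: 'a set"] by simp
    with dim show False by simp
  qed
  then obtain b2 where b2: "b2 \<in> Basis" "b2 \<noteq> b1" by blast
  then have "b2 - b1 \<in> ?L" "b2 - b1 \<noteq> 0"
    using b1 by (simp_all add: inner_diff_left inner_Basis_One)
  then have L0: "?L \<noteq> {0}" by blast
  note U = solid_angle_uniform[OF span_vertex_cone[OF b1] L0]
  have C: "vertex_cone b1 \<in> sets borel" by measurable
  show ?thesis
    unfolding U(1)[OF C]
    by (rule reflection_invariant_eq_center_gauss[OF dim U(2-5) C vertex_cone_scale]) auto
qed

section \<open>Sign patterns of the affine relation\<close>

lemma Basis_real_vec: "(Basis :: (real^'n) set) = range (\<lambda>i. axis i 1)"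
  by (auto simp: Basis_vec_def)

lemma axis_1_in_Basis: "axis i (1::real) \<in> Basis"
  by (auto simp: Basis_vec_def)

lemma inner_axis_1: "x \<bullet> axis i (1::real) = x $ i"
  by (simp add: inner_axis)

lemma One_vec: "(One :: real^'n) = 1"
proof -
  have "(One :: real^'n) $ i = 1" for i
    using inner_One_Basis[OF axis_1_in_Basis[of i]] by (simp only: inner_axis_1)
  then show ?thesis by (simp only: vec_eq_iff one_index simp_thms)
qed

lemma inner_vec_1: "x \<bullet> (1 :: real^'n) = (\<Sum>j\<in>UNIV. x $ j)"
  by (simp add: inner_vec_def)

lemma mem_vertex_cone_axis:
  "x \<in> vertex_cone (axis i (1::real)) \<longleftrightarrow> (\<Sum>j\<in>UNIV. x $ j) = 0 \<and> (\<forall>j. j \<noteq> i \<longrightarrow> 0 \<le> x $ j)"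
proof -
  have "Basis - {axis i 1} = (\<lambda>j. axis j (1::real)) ` (UNIV - {i})"
    by (auto simp: Basis_real_vec axis_eq_axis)
  then show ?thesis
    unfolding vertex_cone_def mem_Collect_eq One_vec inner_vec_1 by (auto simp: inner_axis_1)
qed

lemma vertex_cone_axis_iff:
  fixes x :: "real^'n"
  assumes sum0: "(\<Sum>j\<in>UNIV. x $ j) = 0" and nz: "\<And>j. x $ j \<noteq> 0"
  shows "x \<in> vertex_cone (axis i 1) \<longleftrightarrow> {j. x $ j < 0} = {i}"
proof
  assume "x \<in> vertex_cone (axis i 1)"
  then have nonneg: "0 \<le> x $ j" if "j \<noteq> i" for j using that by (simp add: mem_vertex_cone_axis)
  have "x $ i < 0"
  proof (rule ccontr)
    assume "\<not> x $ i < 0"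
    then have "\<forall>j\<in>UNIV. 0 \<le> x $ j" using nonneg by (metis not_less)
    then have "x $ i = 0" using sum0 by (simp add: sum_nonneg_eq_0_iff)
    with nz show False by simp
  qed
  then show "{j. x $ j < 0} = {i}" using nonneg by (auto simp: not_less[symmetric])
next
  assume "{j. x $ j < 0} = {i}"
  then show "x \<in> vertex_cone (axis i 1)"
    using sum0 by (auto simp: mem_vertex_cone_axis set_eq_iff not_less[symmetric])
qed

text \<open>
  For a vector without zero entries and with sum 0 the pattern means that exactly one entry is negative or exactly one
  is positive. The first case puts \<open>x\<close> into one vertex cone, the second \<open>- x\<close>. The two cases exclude
  each other because there are at least three entries.
\<close>

lemma sign_pattern_indicator:
  fixes x :: "real^'n"
  assumes card: "CARD('n) \<ge> 3" and sum0: "(\<Sum>j\<in>UNIV. x $ j) = 0" and nz: "\<And>j. x $ j \<noteq> 0"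
  shows "indicator {x. \<exists>i. x $ i \<noteq> 0 \<and> (\<forall>j. j \<noteq> i \<longrightarrow> x $ j * x $ i \<le> 0)} x
    = (\<Sum>i\<in>UNIV. indicator (vertex_cone (axis i 1)) x + indicator (vertex_cone (axis i 1)) (- x) :: real)"
proof -
  define N where "N = {j. x $ j < 0}"
  define P where "P = {j. 0 < x $ j}"
  have single: "(\<Sum>i\<in>UNIV. if A = {i} then 1 else 0 :: real) = (if \<exists>i. A = {i} then 1 else 0)" for A :: "'n set"
  proof (cases "\<exists>i. A = {i}")
    case True
    then obtain i where "A = {i}" by blast
    then show ?thesis by simp
  qed simp
  have c: "indicator (vertex_cone (axis i 1)) x = (if N = {i} then 1 else 0 :: real)" for i
    unfolding N_def using vertex_cone_axis_iff[OF sum0 nz, of i] by (simp add: indicator_def)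
  have c': "indicator (vertex_cone (axis i 1)) (- x) = (if P = {i} then 1 else 0 :: real)" for i
    unfolding P_def using vertex_cone_axis_iff[of "- x" i] sum0 nz by (simp add: indicator_def sum_negf)
  have D: "(\<exists>i. x $ i \<noteq> 0 \<and> (\<forall>j. j \<noteq> i \<longrightarrow> x $ j * x $ i \<le> 0)) \<longleftrightarrow> (\<exists>i. N = {i}) \<or> (\<exists>i. P = {i})"
  proof
    assume "\<exists>i. x $ i \<noteq> 0 \<and> (\<forall>j. j \<noteq> i \<longrightarrow> x $ j * x $ i \<le> 0)"
    then obtain i where i: "\<And>j. j \<noteq> i \<Longrightarrow> x $ j * x $ i \<le> 0" by blast
    show "(\<exists>i. N = {i}) \<or> (\<exists>i. P = {i})"
    proof (cases "x $ i < 0")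
      case True
      have "\<not> x $ j < 0" if "j \<noteq> i" for j using i[OF that] True mult_neg_neg[of "x $ j" "x $ i"] by linarith
      then have "N = {i}" using True by (auto simp: N_def)
      then show ?thesis by blast
    next
      case False
      then have pos: "0 < x $ i" using nz[of i] by linarith
      have "\<not> 0 < x $ j" if "j \<noteq> i" for j using i[OF that] pos mult_pos_pos[of "x $ j" "x $ i"] by linarith
      then have "P = {i}" using pos by (auto simp: P_def)
      then show ?thesis by blast
    qed
  next
    assume "(\<exists>i. N = {i}) \<or> (\<exists>i. P = {i})"
    then consider i where "N = {i}" | i where "P = {i}" by blast
    then show "\<exists>i. x $ i \<noteq> 0 \<and> (\<forall>j. j \<noteq> i \<longrightarrow> x $ j * x $ i \<le> 0)"
    proof cases
      case (1 i)
      have "x $ i < 0" using 1 by (auto simp: N_def)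
      moreover have "0 \<le> x $ j" if "j \<noteq> i" for j using 1 that by (force simp: N_def set_eq_iff not_less[symmetric])
      ultimately show ?thesis by (intro exI[of _ i]) (auto intro: mult_nonneg_nonpos)
    next
      case (2 i)
      have "0 < x $ i" using 2 by (auto simp: P_def)
      moreover have "x $ j \<le> 0" if "j \<noteq> i" for j using 2 that by (force simp: P_def set_eq_iff not_less[symmetric])
      ultimately show ?thesis by (intro exI[of _ i]) (auto intro: mult_nonpos_nonneg)
    qed
  qed
  have "\<not> ((\<exists>i. N = {i}) \<and> (\<exists>i. P = {i}))"
  proof
    assume "(\<exists>i. N = {i}) \<and> (\<exists>i. P = {i})"
    then obtain i i' where "N = {i}" "P = {i'}" by blast
    moreover have "UNIV = N \<union> P" using nz by (auto simp: N_def P_def linorder_neq_iff)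
    ultimately have "UNIV = {i, i'}" by auto
    then have "CARD('n) = card {i, i'}" by (rule arg_cong)
    also have "\<dots> \<le> 2" by (simp add: card_insert_if)
    finally show False using card by simp
  qed
  then show ?thesis
    unfolding sum.distrib c c' single by (auto simp: indicator_def D)
qed

context gale
begin

definition gale_law :: "(real^'n) measure" where
  "gale_law = distr std_gauss borel gale_vector"

lemma prob_space_gale_law: "prob_space gale_law"
proof -
  interpret prob_space "std_gauss :: (real^'n^'d) measure" by (rule prob_space_std_gauss)
  show ?thesis unfolding gale_law_def by (rule prob_space_distr) measurable
qed

lemma sets_gale_law [measurable_cong, simp]: "sets gale_law = sets borel"
  and space_gale_law [simp]: "space gale_law = UNIV"
  by (simp_all add: gale_law_def)

lemma AE_gale_law: "AE x in gale_law. x \<in> {x. x \<bullet> One = 0} - {0}"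
proof -
  have [measurable]: "{x :: real^'n. x \<bullet> One = 0} \<in> sets borel" by measurable
  show ?thesis
    unfolding gale_law_def using AE_std_gauss[OF AE_gale_vector_nonzero]
    by (subst AE_distr_iff) (auto simp: One_vec)
qed

text \<open>
  Changing the sign of one row preserves the Gaussian law and flips the sign of the minors.
\<close>

lemma distr_gale_law_uminus: "distr gale_law borel uminus = gale_law"
proof -
  fix k0 :: 'd
  let ?F = "\<lambda>R :: real^'n^'d. \<chi> k. if k = k0 then - (R $ k) else R $ k"
  have F: "orthogonal_transformation ?F"
    unfolding orthogonal_transformation_def
    by (auto intro!: linearI sum.cong simp: vec_eq_iff inner_vec_def)
  then have lin: "linear ?F" by (simp add: orthogonal_transformation_def)
  have [measurable]: "?F \<in> borel_measurable borel"
    using lin by (intro borel_measurable_continuous_onI linear_continuous_on) (simp add: linear_conv_bounded_linear)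
  have "distr gale_law borel uminus = distr std_gauss borel (\<lambda>R. gale_vector (?F R))"
    unfolding gale_law_def gale_vector_flip by (subst distr_distr) (auto simp: comp_def)
  also have "\<dots> = distr (distr std_gauss borel ?F) borel gale_vector"
    by (subst distr_distr) (auto simp: comp_def)
  also have "\<dots> = gale_law" by (simp add: distr_std_gauss_isometry[OF F] gale_law_def)
  finally show ?thesis .
qed

text \<open>
  Equivariance of the minors holds up to a sign, and the symmetry of their law absorbs it.
\<close>

lemma distr_gale_law_reflect:
  assumes v: "v \<bullet> One = 0"
  shows "distr gale_law borel (reflect v) = gale_law"
proof -
  let ?T = "\<lambda>R :: real^'n^'d. \<chi> k. reflect v (R $ k)"
  have T: "orthogonal_transformation ?T"
    unfolding orthogonal_transformation_def
  proof (intro conjI allI)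
    show "linear ?T"
      by (intro linearI) (simp_all add: vec_eq_iff linear_add[OF linear_reflect] linear_cmul[OF linear_reflect])
    show "?T R \<bullet> ?T S = R \<bullet> S" for R S
      by (subst (1 2) inner_vec_def) simp
  qed
  then have lin: "linear ?T" by (simp add: orthogonal_transformation_def)
  have [measurable]: "?T \<in> borel_measurable borel"
    using lin by (intro borel_measurable_continuous_onI linear_continuous_on) (simp add: linear_conv_bounded_linear)
  have "reflect v 1 = 1" using v by (simp add: reflect_def One_vec inner_commute[of 1 v])
  then obtain s :: real where s: "s \<in> {1, -1}" "\<And>R. gale_vector (?T R) = s *\<^sub>R reflect v (gale_vector R)"
    using gale_vector_orthogonal[OF orthogonal_transformation_reflect] by blast
  then have gale_vector_T: "reflect v (gale_vector R) = s *\<^sub>R gale_vector (?T R)" for R by auto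
  have "distr gale_law borel (reflect v) = distr std_gauss borel (\<lambda>R. s *\<^sub>R gale_vector (?T R))"
    unfolding gale_law_def gale_vector_T[symmetric] by (subst distr_distr) (auto simp: comp_def)
  also have "\<dots> = distr (distr (distr std_gauss borel ?T) borel gale_vector) borel (\<lambda>x. s *\<^sub>R x)"
    by (simp add: distr_distr comp_def)
  also have "\<dots> = distr gale_law borel (\<lambda>x. s *\<^sub>R x)"
    by (simp add: distr_std_gauss_isometry[OF T] gale_law_def)
  also have "\<dots> = gale_law"
    using s(1) distr_gale_law_uminus by (auto simp: distr_id2)
  finally show ?thesis .
qed

lemma measure_gale_law_cone:
  assumes K: "K \<in> sets borel" and cone: "\<And>c x. 0 < c \<Longrightarrow> x \<in> K \<Longrightarrow> c *\<^sub>R x \<in> K"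
  shows "measure gale_law K = measure center_gauss K"
  by (rule reflection_invariant_eq_center_gauss[OF _ prob_space_gale_law sets_gale_law AE_gale_law distr_gale_law_reflect K cone])
     (simp_all add: card_n)

text \<open>
  The hyperplane \<open>x $ i = 0\<close> is a cone, so its probability can be read off from the centred Gaussian.
\<close>

lemma AE_gale_law_coord: "AE x in gale_law. x $ i \<noteq> 0"
proof -
  interpret L: prob_space gale_law by (rule prob_space_gale_law)
  interpret C: prob_space "center_gauss :: (real^'n) measure" by (rule prob_space_center_gauss)
  let ?K = "{x :: real^'n. x $ i = 0}"
  have K[measurable]: "?K \<in> sets borel" by measurable
  have KC: "?K \<in> sets center_gauss" by (simp add: sets_center_gauss)
  have "AE x in center_gauss. x \<notin> ?K"
    using AE_center_gauss_coord[OF _ axis_1_in_Basis[of i]] card_n by (simp add: inner_axis_1)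
  then have "measure center_gauss ?K = 0"
    using KC by (simp add: C.prob_eq_0)
  then have "measure gale_law ?K = 0" using measure_gale_law_cone[OF K] by simp
  then have "AE x in gale_law. x \<notin> ?K" using K by (subst (asm) L.prob_eq_0) simp_all
  then show ?thesis by simp
qed

text \<open>
  There are \<open>2 * CARD('n)\<close> cones, the vertex cones and their negatives, all of probability \<open>q\<close> and disjoint
  up to null sets.
\<close>

theorem measure_gale_law_sign_pattern:
  assumes q: "\<And>i. measure gale_law (vertex_cone (axis i 1)) = q"
  shows "measure gale_law {x. \<exists>i. x $ i \<noteq> 0 \<and> (\<forall>j. j \<noteq> i \<longrightarrow> x $ j * x $ i \<le> 0)} = 2 * real CARD('n) * q"
proof -
  interpret prob_space gale_law by (rule prob_space_gale_law)
  let ?D = "{x :: real^'n. \<exists>i. x $ i \<noteq> 0 \<and> (\<forall>j. j \<noteq> i \<longrightarrow> x $ j * x $ i \<le> 0)}"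
  let ?C = "\<lambda>i :: 'n. vertex_cone (axis i (1::real))"
  have [measurable]: "?C i \<in> sets borel" for i using closed_vertex_cone by (rule borel_closed)
  have [measurable]: "?D \<in> sets borel" by measurable
  have card: "CARD('n) \<ge> 3" using card_n by (simp add: Suc_le_eq)
  have neg: "measure gale_law (uminus -` ?C i) = q" for i
  proof -
    have "q = measure (distr gale_law borel uminus) (?C i)" by (simp add: distr_gale_law_uminus q)
    also have "\<dots> = measure gale_law (uminus -` ?C i)" by (subst measure_distr) auto
    finally show ?thesis ..
  qed
  have [measurable]: "uminus -` ?C i \<in> sets borel" for i
    using measurable_sets_borel[of uminus borel "?C i"] by simp
  have "measure gale_law ?D = (\<integral>x. indicator ?D x \<partial>gale_law)" by simp
  also have "\<dots> = (\<integral>x. (\<Sum>i\<in>UNIV. indicator (?C i) x + indicator (uminus -` ?C i) x) \<partial>gale_law)"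
  proof (rule integral_cong_AE)
    have "AE x in gale_law. \<forall>i\<in>UNIV. x $ i \<noteq> 0" by (subst AE_finite_all) (auto intro: AE_gale_law_coord)
    with AE_gale_law show "AE x in gale_law. indicator ?D x = (\<Sum>i\<in>UNIV. indicator (?C i) x + indicator (uminus -` ?C i) x :: real)"
    proof eventually_elim
      case (elim x)
      then have "indicator ?D x = (\<Sum>i\<in>UNIV. indicator (?C i) x + indicator (?C i) (- x) :: real)"
        by (intro sign_pattern_indicator[OF card]) (auto simp: One_vec inner_vec_def)
      then show ?case by (simp add: indicator_def)
    qed
  qed measurable
  also have "\<dots> = (\<Sum>i\<in>UNIV. (\<integral>x. indicator (?C i) x + indicator (uminus -` ?C i) x \<partial>gale_law))"
    by (rule Bochner_Integration.integral_sum) (auto simp: less_top[symmetric])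
  also have "\<dots> = (\<Sum>i\<in>(UNIV :: 'n set). 2 * q)"
  proof (rule sum.cong[OF refl])
    fix i
    have "(\<integral>x. indicator (?C i) x + indicator (uminus -` ?C i) x \<partial>gale_law) = measure gale_law (?C i) + measure gale_law (uminus -` ?C i)"
      by (subst Bochner_Integration.integral_add) (auto simp: less_top[symmetric])
    then show "(\<integral>x. indicator (?C i) x + indicator (uminus -` ?C i) x \<partial>gale_law) = 2 * q"
      by (simp add: q neg)
  qed
  finally show ?thesis by simp
qed

theorem measure_std_gauss_simplex:
  assumes q: "\<And>i. measure gale_law (vertex_cone (axis i 1)) = q"
  defines "E \<equiv> {R :: real^'n^'d. int CARD('d) simplex (convex hull (range (\<lambda>i. \<chi> k. R $ k $ i)))}"
  shows "E \<in> sets borel" and "measure std_gauss E = 2 * real CARD('n) * q"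
proof -
  let ?D = "{x :: real^'n. \<exists>i. x $ i \<noteq> 0 \<and> (\<forall>j. j \<noteq> i \<longrightarrow> x $ j * x $ i \<le> 0)}"
  have D: "?D \<in> sets borel" by measurable
  have E: "E = gale_vector -` ?D" unfolding E_def simplex_iff_gale_vector by auto
  then show "E \<in> sets borel" using measurable_sets_borel[OF measurable_gale_vector D] by simp
  show "measure std_gauss E = 2 * real CARD('n) * q"
    unfolding E measure_gale_law_sign_pattern[OF q, symmetric] gale_law_def using D by (subst measure_distr) auto
qed

end

section \<open>The probability that a Gaussian sample spans a simplex\<close>

theorem theorem2p1:
  fixes M :: "'w measure"
    and d :: nat
    and X :: "nat \<Rightarrow> 'w \<Rightarrow> real ^ 'd"
    and e :: "nat \<Rightarrow> real ^ 'n"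
  assumes "prob_space M"
    and "CARD('d) = d"
    and "prob_space.indep_vars M (\<lambda>_. borel) X {1..d + 2}"
    and "\<And>i. i \<in> {1..d + 2} \<Longrightarrow> distributed M lborel (X i) (\<lambda>x. ennreal (std_gauss_density x))"
    and "bij_betw e {1..d + 2} (Basis :: (real ^ 'n) set)"
  shows "measure M {\<omega> \<in> space M. int d simplex (convex hull ((\<lambda>i. X i \<omega>) ` {1..d + 2}))}
           = 2 * J1_inf (d + 2) e
       \<and> complex_of_real (2 * J1_inf (d + 2) e)
           = complex_of_real (2 * real (d + 2) / sqrt (2 * pi)) *
             (\<integral>x. Phi (\<i> * complex_of_real (x / sqrt (real (d + 2)))) ^ (d + 1)
                   * complex_of_real (exp (- x\<^sup>2 / 2)) \<partial>lborel)"
proof -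
  let ?I = "{1..d + 2}"
  have n: "CARD('n) = d + 2" using bij_betw_same_card[OF assms(5)] by simp
  obtain r0 r1 :: 'n where r: "r0 \<noteq> r1"
  proof -
    obtain T :: "'n set" where "card T = 2" using obtain_subset_with_card_n[of 2 "UNIV :: 'n set"] n by auto
    then show thesis using that by (auto simp: card_2_iff)
  qed
  have "card (UNIV - {r0, r1}) = CARD('d)" using n r assms(2) by (simp add: card_Diff_subset)
  then obtain f :: "'d \<Rightarrow> 'n" where f: "bij_betw f UNIV (UNIV - {r0, r1})"
    using finite_same_card_bij[of "UNIV :: 'd set" "UNIV - {r0, r1}"] by auto
  interpret gale r0 r1 f
    using r f by unfold_locales (auto simp: bij_betw_def)
  define q where "q = measure gale_law (vertex_cone (axis r0 1))"
  have cone: "complex_of_real (measure gale_law (vertex_cone b)) = complex_of_real (1 / sqrt (2 * pi)) *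
      (\<integral>x. Phi (\<i> * complex_of_real (x / sqrt (real (d + 2)))) ^ (d + 1) * complex_of_real (exp (- x\<^sup>2 / 2)) \<partial>lborel)"
    and cone': "measure gale_law (vertex_cone b) = measure center_gauss (vertex_cone b)"
    if b: "b \<in> Basis" for b
  proof -
    show eq: "measure gale_law (vertex_cone b) = measure center_gauss (vertex_cone b)"
      by (rule measure_gale_law_cone[OF borel_closed[OF closed_vertex_cone] vertex_cone_scale])
    show "complex_of_real (measure gale_law (vertex_cone b)) = complex_of_real (1 / sqrt (2 * pi)) *
      (\<integral>x. Phi (\<i> * complex_of_real (x / sqrt (real (d + 2)))) ^ (d + 1) * complex_of_real (exp (- x\<^sup>2 / 2)) \<partial>lborel)"
      unfolding eq measure_center_gauss_vertex_cone[OF b] by (simp add: n)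
  qed
  have "complex_of_real (measure gale_law (vertex_cone b)) = complex_of_real q" if "b \<in> Basis" for b
    unfolding q_def cone[OF that] by (rule cone[symmetric]) (rule axis_1_in_Basis)
  then have q: "measure gale_law (vertex_cone b) = q" if "b \<in> Basis" for b
    using that by (simp only: of_real_eq_iff)
  have e1: "e 1 \<in> Basis" using assms(5) by (auto simp: bij_betw_def)
  have J: "J1_inf (d + 2) e = real (d + 2) * q"
  proof -
    have "e ` {2..d + 2} = Basis - {e 1}"
    proof -
      have "{2..d + 2} = ?I - {1}" by auto
      moreover have "e ` (?I - {1}) = e ` ?I - e ` {1}"
        using assms(5) by (intro inj_on_image_set_diff[where C="?I"]) (auto simp: bij_betw_def)
      ultimately show ?thesis using assms(5) by (simp add: bij_betw_def)
    qed
    moreover have "(\<lambda>k. e k - e 1) ` {2..d + 2} = (\<lambda>b. b - e 1) ` e ` {2..d + 2}"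
      unfolding image_image ..
    ultimately have "(\<lambda>k. e k - e 1) ` {2..d + 2} = (\<lambda>b. b - e 1) ` (Basis - {e 1})"
      by simp
    then have "J1_inf (d + 2) e = real (d + 2) * solid_angle (vertex_cone (e 1))"
      by (simp only: J1_inf_def pos_hull_eq_vertex_cone[OF e1])
    also have "solid_angle (vertex_cone (e 1)) = q"
      using solid_angle_vertex_cone[OF e1] cone'[OF e1] q[OF e1] n by simp
    finally show ?thesis .
  qed
  \<comment> \<open>The coordinates of the affine relation are labelled by \<open>'n\<close>; the enumeration \<open>e\<close> translates them into sample numbers.\<close>
  define idx where "idx i = inv_into ?I e (axis i 1)" for i
  have idx: "bij_betw idx UNIV ?I"
  proof -
    have "bij_betw (\<lambda>i. axis i (1::real)) UNIV (Basis :: (real^'n) set)"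
      by (auto simp: bij_betw_def inj_on_def axis_eq_axis Basis_vec_def)
    from bij_betw_trans[OF this bij_betw_inv_into[OF assms(5)]]
    show ?thesis by (simp add: idx_def[abs_def] comp_def)
  qed
  let ?R = "\<lambda>\<omega>. rows_of idx (\<lambda>i. X i \<omega>)"
  note law = joint_law_rows[OF finite_atLeastAtMost idx assms(1,3,4)]
  define E where "E = {R :: real^'n^'d. int CARD('d) simplex (convex hull (range (\<lambda>i. \<chi> k. R $ k $ i)))}"
  have E: "E \<in> sets borel" "measure std_gauss E = 2 * real CARD('n) * q"
    unfolding E_def by (rule measure_std_gauss_simplex; rule q; rule axis_1_in_Basis)+
  have "{\<omega> \<in> space M. int d simplex (convex hull ((\<lambda>i. X i \<omega>) ` ?I))} = ?R -` E \<inter> space M"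
  proof -
    have "(\<lambda>i. X i \<omega>) ` ?I = range (\<lambda>i. \<chi> k. ?R \<omega> $ k $ i)" for \<omega>
    proof -
      have "(\<lambda>i. X i \<omega>) ` ?I = (\<lambda>i. X i \<omega>) ` range idx"
        using idx by (simp add: bij_betw_def)
      also have "\<dots> = range (\<lambda>i. X (idx i) \<omega>)" unfolding image_image ..
      also have "(\<lambda>i. X (idx i) \<omega>) = (\<lambda>i. \<chi> k. ?R \<omega> $ k $ i)"
        by (simp add: rows_of_def[OF finite_atLeastAtMost idx] fun_eq_iff vec_eq_iff)
      finally show ?thesis .
    qed
    then show ?thesis by (auto simp: E_def assms(2))
  qed
  then have "measure M {\<omega> \<in> space M. int d simplex (convex hull ((\<lambda>i. X i \<omega>) ` ?I))} = measure (distr M borel ?R) E"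
    using law(1) E(1) by (simp add: measure_distr)
  also have "\<dots> = 2 * J1_inf (d + 2) e" by (simp only: law(2) E(2) n J mult.assoc)
  finally have 1: "measure M {\<omega> \<in> space M. int d simplex (convex hull ((\<lambda>i. X i \<omega>) ` ?I))} = 2 * J1_inf (d + 2) e" .
  have 2: "complex_of_real (2 * J1_inf (d + 2) e) = complex_of_real (2 * real (d + 2)) * complex_of_real (measure gale_law (vertex_cone (e 1)))"
    by (simp only: J q[OF e1] of_real_mult mult.assoc)
  have 3: "complex_of_real (2 * real (d + 2) / sqrt (2 * pi)) = complex_of_real (2 * real (d + 2)) * complex_of_real (1 / sqrt (2 * pi))"
    unfolding of_real_mult[symmetric] by simp
  show ?thesis
    using 1 2 unfolding cone[OF e1] 3 mult.assoc by (rule conjI)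
qed

end
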